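(* Let $\Omega\subseteq\mathbb R^k$ be open with finite Lebesgue measure, let $F:L^2(\Omega)\to L^2(\Omega)$, and let $F_{\mathbb X}:\mathbb G(\Omega_{\mathbb X})\to\mathbb G(\Omega_{\mathbb X})$ satisfy: (1) whenever $u,v\in\mathbb G(\Omega_{\mathbb X})$ are nearstandard in $L^2(\Omega)$, $\|u-v\|_2\approx0$ implies $\|F_{\mathbb X}(u)-F_{\mathbb X}(v)\|_2\approx0$; (2) for all $g\in L^2(\Omega)$, $[F_{\mathbb X}(P({}^*g))]=F(g)$. Let also $f\in L^2(\Omega)$. Then the problem of finding $v\in L^2(\Omega)$ satisfying $F(v)=f$ has a solution if and only if there exists a solution $u\in\mathbb G(\Omega_{\mathbb X})$, $u$ nearstandard in $L^2(\Omega)$, of $$F_{\mathbb X}(u)=f_{\mathbb X}$$ for some $f_{\mathbb X}\in\mathbb G(\Omega_{\mathbb X})$ with $[f_{\mathbb X}]=f$, and in particular for $f_{\mathbb X}=P({}^*f)$.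
   Context: Work in a $|\mathscr D'(\Omega)|$-saturated nonstandard extension $A\mapsto{}^*A$ of the standard universe; $x\approx y$ means $x-y$ is infinitesimal; ${}^\circ x$ is the standard part of a finite $x$, and for a set $X\subseteq{}^*\mathbb R^k$, ${}^\circ X$ is the set of the standard parts of the finite elements of $X$. Fix an infinite $N_0\in{}^*\mathbb N$, let $N=N_0!$, $\varepsilon=1/N$, and $\mathbb X=\{n\varepsilon: n\in{}^*\mathbb Z,\ -N^2\le n\le N^2\}$. $\Omega_{\mathbb X}={}^*\Omega\cap\mathbb X^k$. $\mathbb G(\Omega_{\mathbb X})$ is the set of internal functions $\Omega_{\mathbb X}\to{}^*\mathbb R$. $\langle f,g\rangle=\varepsilon^k\sum_{x\in\Omega_{\mathbb X}}f(x)g(x)$. A grid function $f$ is identified with the internal step function $\widehat f$ on ${}^*\mathbb R^k$ equal to $f(y)$ on the cube $y+[0,\varepsilon)^k$ for $y\in\Omega_{\mathbb X}$ and $0$ elsewhere, so that $\|f\|_2^2=\varepsilon^k\sum_{x\in\Omega_{\mathbb X}}|f(x)|^2$. $\widehat\Omega$ is the support of $\widehat{\chi_{\Omega_{\mathbb X}}}$. $P:{}^*L^2(\widehat\Omega)\to\mathbb G(\Omega_{\mathbb X})$ is the ${}^*L^2$ projection, i.e. $P(g)$ is the unique grid function with $\langle P(g),h\rangle={}^*\!\int_{\widehat\Omega}g\,\widehat h\,dx$ for all $h\in\mathbb G(\Omega_{\mathbb X})$. Functions such as ${}^*f$, $f\in L^2(\Omega)$, are taken to be $0$ outside ${}^*\Omega$.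 $u\in\mathbb G(\Omega_{\mathbb X})$ is nearstandard in $L^2(\Omega)$ if there is $g\in L^2(\Omega)$ with $\|u-P({}^*g)\|_2\approx0$. Finite differences: $\mathbb D_i\varphi(x)=\varepsilon^{-1}(\varphi(x+\varepsilon e_i)-\varphi(x))$ and $\mathbb D^\alpha=\mathbb D_1^{\alpha_1}\cdots\mathbb D_k^{\alpha_k}$ (where defined). A point $x\in\Omega_{\mathbb X}$ is nearstandard in $\Omega$ if $x\approx y$ for some $y\in\Omega$. A grid function is of class $S^0$ if it is finite at some nearstandard point and takes infinitely close values at any two infinitely close nearstandard points; $\varphi$ is of class $S^\infty$ if $\mathbb D^\alpha\varphi$ is of class $S^0$ for every standard multi-index $\alpha$. $\mathscr D_{\mathbb X}(\Omega_{\mathbb X})$ is the set of $\varphi\in\mathbb G(\Omega_{\mathbb X})$ of class $S^\infty$ with ${}^\circ\{x\in\Omega_{\mathbb X}:\varphi(x)\ne0\}$ compactly contained in $\Omega$. If $u\in\mathbb G(\Omega_{\mathbb X})$ is such that $\langle u,\varphi\rangle$ is finite for all $\varphi\in\mathscr D_{\mathbb X}(\Omega_{\mathbb X})$ ($u$ is a grid distribution), $[u]$ is its class under the relation "$\langle u,\varphi\rangle\approx\langle w,\varphi\rangle$ for all $\varphi\in\mathscr D_{\mathbb X}(\Omega_{\mathbb X})$", identified with the distribution $\varphi\mapsto{}^\circ\langle u,{}^*\varphi\rangle$, $\varphi\in\mathscr D(\Omega)$ (smooth functions with compact support in $\Omega$). For $g\in L^2(\Omega)$, $[u]=g$ means that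 $u$ is a grid distribution and this distribution is $\varphi\mapsto\int_\Omega g\varphi\,dx$.
   Formalization: For f_X=P( *f) only one direction is stated: a nearstandard solution of F_X(u)=P( *f) gives a solution of F(v)=f. The converse is false: take Ω=(0,1), F=id, F_X(u)=u+h with h(nε)=(-1)^n, and f=0. *)

theory Defs
  imports "HOL-Analysis.Analysis"
begin

section \<open>Nonstandard extensions\<close>

text \<open>
  The standard universe consists of the HOL types, and a nonstandard extension of it is given as a
  limit ultrapower: an ultrafilter \<open>ultra\<close> on the index type \<open>'i\<close> and a filter \<open>kern\<close> on
  \<open>'i \<times> 'i\<close>; the elements of \<open>*'a\<close> are the classes modulo \<open>ultra\<close> of those maps \<open>'i \<Rightarrow> 'a\<close> whose
  kernel belongs to \<open>kern\<close>.  By Keisler's theorem these are, up to isomorphism, exactly the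
  extensions that satisfy the transfer principle, so nothing is lost by this choice.  Ordinary
  ultrapowers are the case \<open>kern = bot\<close>.
\<close>

class nonstandard_index =
  fixes ultra :: "'a filter"
    and kern :: "('a \<times> 'a) filter"
  assumes ultra_proper: "ultra \<noteq> bot"
    and ultra_total: "eventually P ultra \<or> eventually (\<lambda>i. \<not> P i) ultra"

definition admissible :: "('i::nonstandard_index \<Rightarrow> 'a) \<Rightarrow> bool" where
  "admissible x \<longleftrightarrow> eventually (\<lambda>(i, j). x i = x j) kern"

definition star_eq :: "('i::nonstandard_index \<Rightarrow> 'a) \<Rightarrow> ('i \<Rightarrow> 'a) \<Rightarrow> bool" where
  "star_eq x y \<longleftrightarrow> admissible x \<and> admissible y \<and> eventually (\<lambda>i. x i = y i) ultra"

lemma admissible_const: "admissible (\<lambda>_. a)"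
  by (simp add: admissible_def case_prod_unfold)

lemma admissible_app:
  assumes "admissible f" "admissible x"
  shows "admissible (\<lambda>i. f i (x i))"
  using eventually_conj[OF assms[unfolded admissible_def]]
  unfolding admissible_def by (rule eventually_mono) auto

text \<open>\<open>('a, 'i) star\<close> is \<open>*'a\<close>; its elements are the internal objects of type \<open>'a\<close>.\<close>

quotient_type (overloaded) ('a, 'i) star = "'i::nonstandard_index \<Rightarrow> 'a" / partial: star_eq
proof (rule part_equivpI)
  show "\<exists>x. star_eq x x"
    by (intro exI[of _ "\<lambda>_. undefined"]) (simp add: star_eq_def admissible_const)
  show "symp star_eq"
    by (auto simp: symp_def star_eq_def elim: eventually_mono)
  show "transp star_eq"
    by (auto simp: transp_def star_eq_def elim: eventually_elim2)
qed

lift_definition star_of :: "'a \<Rightarrow> ('a, 'i::nonstandard_index) star" is "\<lambda>a _. a"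
  by (simp add: star_eq_def admissible_const)

lift_definition star_app ::
  "('a \<Rightarrow> 'b, 'i::nonstandard_index) star \<Rightarrow> ('a, 'i) star \<Rightarrow> ('b, 'i) star" is
  "\<lambda>f x i. f i (x i)"
  by (auto simp: star_eq_def admissible_app elim: eventually_elim2)

lift_definition star_holds :: "(bool, 'i::nonstandard_index) star \<Rightarrow> bool" is
  "\<lambda>p. eventually p ultra"
  by (auto simp: star_eq_def elim: eventually_elim2)

text \<open>
  \<open>star_map f\<close> and \<open>star_map2 f\<close> are \<open>*f\<close>; \<open>star_pred\<close> and \<open>star_pred2\<close> extend relations.
\<close>

definition star_map :: "('a \<Rightarrow> 'b) \<Rightarrow> ('a, 'i::nonstandard_index) star \<Rightarrow> ('b, 'i) star" where
  "star_map f x = star_app (star_of f) x"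

definition star_map2 ::
  "('a \<Rightarrow> 'b \<Rightarrow> 'c) \<Rightarrow> ('a, 'i::nonstandard_index) star \<Rightarrow> ('b, 'i) star \<Rightarrow> ('c, 'i) star" where
  "star_map2 f x y = star_app (star_map f x) y"

definition star_map3 ::
  "('a \<Rightarrow> 'b \<Rightarrow> 'c \<Rightarrow> 'd) \<Rightarrow> ('a, 'i::nonstandard_index) star \<Rightarrow> ('b, 'i) star \<Rightarrow> ('c, 'i) star
    \<Rightarrow> ('d, 'i) star" where
  "star_map3 f x y z = star_app (star_map2 f x y) z"

definition star_pred :: "('a \<Rightarrow> bool) \<Rightarrow> ('a, 'i::nonstandard_index) star \<Rightarrow> bool" where
  "star_pred R x \<longleftrightarrow> star_holds (star_map R x)"

definition star_pred2 ::
  "('a \<Rightarrow> 'b \<Rightarrow> bool) \<Rightarrow> ('a, 'i::nonstandard_index) star \<Rightarrow> ('b, 'i) star \<Rightarrow> bool" where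
  "star_pred2 R x y \<longleftrightarrow> star_holds (star_map2 R x y)"

definition internal_set :: "('a set, 'i::nonstandard_index) star \<Rightarrow> ('a, 'i) star set" where
  "internal_set A = {x. star_pred2 (\<in>) x A}"

text \<open>
  \<open>saturated K TYPE('a) TYPE('i)\<close>: every family of fewer than \<open>|K|\<close> internal subsets of \<open>*'a\<close>
  with the finite intersection property has nonempty intersection.
\<close>

definition saturated :: "'k set \<Rightarrow> 'a itself \<Rightarrow> 'i::nonstandard_index itself \<Rightarrow> bool" where
  "saturated K (_ :: 'a itself) (_ :: 'i itself) \<longleftrightarrow>
    (\<forall>\<S> :: ('a, 'i) star set set.
      \<S> \<subseteq> range internal_set \<longrightarrow> (card_of \<S>, card_of K) \<in> ordLess \<longrightarrow>
      (\<forall>\<T>\<subseteq>\<S>. finite \<T> \<longrightarrow> \<Inter>\<T> \<noteq> {}) \<longrightarrow> \<Inter>\<S> \<noteq> {})"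

definition star_infinite :: "(nat, 'i::nonstandard_index) star \<Rightarrow> bool" where
  "star_infinite n \<longleftrightarrow> (\<forall>m::nat. star_pred (\<lambda>k. m < k) n)"

definition star_finite :: "('a::real_normed_vector, 'i::nonstandard_index) star \<Rightarrow> bool" where
  "star_finite x \<longleftrightarrow> (\<exists>r::real. star_pred (\<lambda>a. norm a \<le> r) x)"

definition star_approx ::
  "('a::metric_space, 'i::nonstandard_index) star \<Rightarrow> ('a, 'i) star \<Rightarrow> bool" (infix "\<approx>" 50) where
  "x \<approx> y \<longleftrightarrow> (\<forall>r::real>0. star_pred2 (\<lambda>a b. dist a b < r) x y)"

text \<open>A point infinitely close to a standard point is automatically finite.\<close>

definition std_part_set ::
  "('a::real_normed_vector, 'i::nonstandard_index) star set \<Rightarrow> 'a set" where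
  "std_part_set X = {a. \<exists>x\<in>X. x \<approx> star_of a}"

definition compactly_contained :: "'a::topological_space set \<Rightarrow> 'a set \<Rightarrow> bool" where
  "compactly_contained A B \<longleftrightarrow> compact (closure A) \<and> closure A \<subseteq> B"


section \<open>Test functions and distributions\<close>

definition partial_deriv :: "'n \<Rightarrow> (real^'n::finite \<Rightarrow> real) \<Rightarrow> real^'n \<Rightarrow> real" where
  "partial_deriv i \<phi> x = frechet_derivative \<phi> (at x) (axis i 1)"

definition partial_derivs :: "'n list \<Rightarrow> (real^'n::finite \<Rightarrow> real) \<Rightarrow> real^'n \<Rightarrow> real" where
  "partial_derivs js \<phi> = foldr partial_deriv js \<phi>"

definition smooth :: "(real^'n::finite \<Rightarrow> real) \<Rightarrow> bool" where
  "smooth \<phi> \<longleftrightarrow> (\<forall>js x. partial_derivs js \<phi> differentiable (at x))"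

text \<open>Test functions on \<open>\<Omega>\<close> are extended by \<open>0\<close> to the whole space.\<close>

definition test_functions :: "(real^'n::finite) set \<Rightarrow> (real^'n \<Rightarrow> real) set" where
  "test_functions \<Omega> = {\<phi>. smooth \<phi> \<and> compactly_contained {x. \<phi> x \<noteq> 0} \<Omega>}"

definition test_tendsto ::
  "(real^'n::finite) set \<Rightarrow> (nat \<Rightarrow> real^'n \<Rightarrow> real) \<Rightarrow> (real^'n \<Rightarrow> real) \<Rightarrow> bool" where
  "test_tendsto \<Omega> \<phi> \<psi> \<longleftrightarrow>
    (\<exists>K. compact K \<and> K \<subseteq> \<Omega> \<and> (\<forall>m. {x. \<phi> m x \<noteq> 0} \<subseteq> K)) \<and>
    (\<forall>js. uniform_limit UNIV (\<lambda>m. partial_derivs js (\<phi> m)) (partial_derivs js \<psi>) sequentially)"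

definition distributions :: "(real^'n::finite) set \<Rightarrow> ((real^'n \<Rightarrow> real) \<Rightarrow> real) set" where
  "distributions \<Omega> = {T \<in> extensional (test_functions \<Omega>).
    (\<forall>\<phi>\<in>test_functions \<Omega>. \<forall>\<psi>\<in>test_functions \<Omega>. \<forall>a b.
      T (\<lambda>x. a * \<phi> x + b * \<psi> x) = a * T \<phi> + b * T \<psi>) \<and>
    (\<forall>\<phi> \<psi>. (\<forall>m. \<phi> m \<in> test_functions \<Omega>) \<longrightarrow> \<psi> \<in> test_functions \<Omega> \<longrightarrow>
      test_tendsto \<Omega> \<phi> \<psi> \<longrightarrow> (\<lambda>m. T (\<phi> m)) \<longlonglongrightarrow> T \<psi>)}"


section \<open>The space \<open>L\<^sup>2\<close>\<close>

definition square_integrable :: "(real^'n::finite \<Rightarrow> real) \<Rightarrow> bool" where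
  "square_integrable f \<longleftrightarrow>
    f \<in> borel_measurable lebesgue \<and> integrable lebesgue (\<lambda>x. (f x)\<^sup>2)"

definition L2_eq :: "(real^'n::finite \<Rightarrow> real) \<Rightarrow> (real^'n \<Rightarrow> real) \<Rightarrow> bool" where
  "L2_eq f g \<longleftrightarrow> square_integrable f \<and> square_integrable g \<and> (AE x in lebesgue. f x = g x)"

text \<open>
  Square integrable functions on the whole space modulo equality almost everywhere.  The function
  \<open>rep_L2\<close> picks a representative; it is only used in ways that do not depend on the choice.
\<close>

quotient_type 'n L2 = "real^'n::finite \<Rightarrow> real" / partial: L2_eq
proof (rule part_equivpI)
  show "\<exists>f. L2_eq f f"
    by (intro exI[of _ "\<lambda>_. 0"]) (simp add: L2_eq_def square_integrable_def)
  show "symp L2_eq"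
    by (auto simp: symp_def L2_eq_def elim: eventually_mono)
  show "transp L2_eq"
    by (auto simp: transp_def L2_eq_def elim: eventually_elim2)
qed

text \<open>\<open>L\<^sup>2(\<Omega>)\<close>, its elements being extended by \<open>0\<close> outside \<open>\<Omega>\<close>.\<close>

definition L2_on :: "(real^'n::finite) set \<Rightarrow> 'n L2 set" where
  "L2_on \<Omega> = {g. AE x in lebesgue. x \<notin> \<Omega> \<longrightarrow> rep_L2 g x = 0}"


section \<open>Grids\<close>

text \<open>
  The notions of this section are standard and depend on a natural number \<open>N\<close>, with \<open>\<epsilon> = 1/N\<close>.
  The internal notions are their extensions, taken at the hypernatural \<open>N = N\<^sub>0!\<close>.
\<close>

definition grid :: "nat \<Rightarrow> real set" where
  "grid N = {real_of_int n * (1 / real N) | n. - (int N)\<^sup>2 \<le> n \<and> n \<le> (int N)\<^sup>2}"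

definition domain_grid :: "(real^'n::finite) set \<Rightarrow> nat \<Rightarrow> (real^'n) set" where
  "domain_grid \<Omega> N = {x \<in> \<Omega>. \<forall>i. x $ i \<in> grid N}"

text \<open>Functions on the grid are represented by their extensions by \<open>0\<close>.\<close>

definition grid_fun :: "(real^'n::finite) set \<Rightarrow> nat \<Rightarrow> (real^'n \<Rightarrow> real) set" where
  "grid_fun \<Omega> N = {f. \<forall>x. x \<notin> domain_grid \<Omega> N \<longrightarrow> f x = 0}"

definition grid_inner ::
  "(real^'n::finite) set \<Rightarrow> nat \<Rightarrow> (real^'n \<Rightarrow> real) \<Rightarrow> (real^'n \<Rightarrow> real) \<Rightarrow> real" where
  "grid_inner \<Omega> N f g = (1 / real N) ^ CARD('n) * (\<Sum>x\<in>domain_grid \<Omega> N. f x * g x)"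

definition grid_norm :: "(real^'n::finite) set \<Rightarrow> nat \<Rightarrow> (real^'n \<Rightarrow> real) \<Rightarrow> real" where
  "grid_norm \<Omega> N f = sqrt ((1 / real N) ^ CARD('n) * (\<Sum>x\<in>domain_grid \<Omega> N. \<bar>f x\<bar>\<^sup>2))"

definition cube :: "nat \<Rightarrow> real^'n::finite \<Rightarrow> (real^'n) set" where
  "cube N y = {z. \<forall>i. y $ i \<le> z $ i \<and> z $ i < y $ i + 1 / real N}"

text \<open>The cubes with corners on the grid are disjoint, so the sum has at most one nonzero term.\<close>

definition step_fun ::
  "(real^'n::finite) set \<Rightarrow> nat \<Rightarrow> (real^'n \<Rightarrow> real) \<Rightarrow> real^'n \<Rightarrow> real" where
  "step_fun \<Omega> N f z = (\<Sum>y\<in>domain_grid \<Omega> N. f y * indicator (cube N y) z)"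

definition domain_hat :: "(real^'n::finite) set \<Rightarrow> nat \<Rightarrow> (real^'n) set" where
  "domain_hat \<Omega> N = {z. step_fun \<Omega> N (indicator (domain_grid \<Omega> N)) z \<noteq> 0}"

definition grid_proj :: "(real^'n::finite) set \<Rightarrow> nat \<Rightarrow> 'n L2 \<Rightarrow> real^'n \<Rightarrow> real" where
  "grid_proj \<Omega> N g = (THE p. p \<in> grid_fun \<Omega> N \<and>
    (\<forall>h\<in>grid_fun \<Omega> N.
      grid_inner \<Omega> N p h = (LINT z:domain_hat \<Omega> N|lebesgue. rep_L2 g z * step_fun \<Omega> N h z)))"

definition grid_diff :: "nat \<Rightarrow> 'n \<Rightarrow> (real^'n::finite \<Rightarrow> real) \<Rightarrow> real^'n \<Rightarrow> real" where
  "grid_diff N i \<phi> x = (\<phi> (x + (1 / real N) *\<^sub>R axis i 1) - \<phi> x) / (1 / real N)"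

text \<open>The operators \<open>grid_diff N i\<close> commute, so the order of composition does not matter.\<close>

definition grid_diffs ::
  "('n \<Rightarrow> nat) \<Rightarrow> nat \<Rightarrow> (real^'n::finite \<Rightarrow> real) \<Rightarrow> real^'n \<Rightarrow> real" where
  "grid_diffs \<alpha> N \<phi> = Finite_Set.fold (\<lambda>i. grid_diff N i ^^ \<alpha> i) \<phi> UNIV"


section \<open>Grid functions\<close>

type_synonym ('n, 'i) internal_fun = "(real^'n \<Rightarrow> real, 'i) star"

definition Omega_X ::
  "(real^'n::finite) set \<Rightarrow> (nat, 'i::nonstandard_index) star \<Rightarrow> (real^'n, 'i) star set" where
  "Omega_X \<Omega> N = internal_set (star_map (domain_grid \<Omega>) N)"

definition grid_functions ::
  "(real^'n::finite) set \<Rightarrow> (nat, 'i::nonstandard_index) star \<Rightarrow> ('n, 'i) internal_fun set" where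
  "grid_functions \<Omega> N = internal_set (star_map (grid_fun \<Omega>) N)"

definition inner_X ::
  "(real^'n::finite) set \<Rightarrow> (nat, 'i::nonstandard_index) star \<Rightarrow> ('n, 'i) internal_fun
    \<Rightarrow> ('n, 'i) internal_fun \<Rightarrow> (real, 'i) star" where
  "inner_X \<Omega> N u v = star_map3 (grid_inner \<Omega>) N u v"

definition norm_X ::
  "(real^'n::finite) set \<Rightarrow> (nat, 'i::nonstandard_index) star \<Rightarrow> ('n, 'i) internal_fun
    \<Rightarrow> (real, 'i) star" where
  "norm_X \<Omega> N u = star_map2 (grid_norm \<Omega>) N u"

definition diff_X ::
  "('n::finite, 'i::nonstandard_index) internal_fun \<Rightarrow> ('n, 'i) internal_fun
    \<Rightarrow> ('n, 'i) internal_fun" where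
  "diff_X u v = star_map2 (\<lambda>f g x. f x - g x) u v"

text \<open>\<open>proj_X \<Omega> N g\<close> is \<open>P(*g)\<close>.\<close>

definition proj_X ::
  "(real^'n::finite) set \<Rightarrow> (nat, 'i::nonstandard_index) star \<Rightarrow> 'n L2 \<Rightarrow> ('n, 'i) internal_fun"
  where
  "proj_X \<Omega> N g = star_map2 (grid_proj \<Omega>) N (star_of g)"

definition nearstandard_L2 ::
  "(real^'n::finite) set \<Rightarrow> (nat, 'i::nonstandard_index) star \<Rightarrow> ('n, 'i) internal_fun \<Rightarrow> bool"
  where
  "nearstandard_L2 \<Omega> N u \<longleftrightarrow> u \<in> grid_functions \<Omega> N \<and>
    (\<exists>g\<in>L2_on \<Omega>. norm_X \<Omega> N (diff_X u (proj_X \<Omega> N g)) \<approx> star_of 0)"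

definition nearstandard_points ::
  "(real^'n::finite) set \<Rightarrow> (nat, 'i::nonstandard_index) star \<Rightarrow> (real^'n, 'i) star set" where
  "nearstandard_points \<Omega> N = {x \<in> Omega_X \<Omega> N. \<exists>y\<in>\<Omega>. x \<approx> star_of y}"

definition class_S0 ::
  "(real^'n::finite) set \<Rightarrow> (nat, 'i::nonstandard_index) star \<Rightarrow> ('n, 'i) internal_fun \<Rightarrow> bool"
  where
  "class_S0 \<Omega> N \<phi> \<longleftrightarrow>
    (\<exists>x\<in>nearstandard_points \<Omega> N. star_finite (star_app \<phi> x)) \<and>
    (\<forall>x\<in>nearstandard_points \<Omega> N. \<forall>y\<in>nearstandard_points \<Omega> N.
      x \<approx> y \<longrightarrow> star_app \<phi> x \<approx> star_app \<phi> y)"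

text \<open>
  As \<open>\<Omega>\<close> is open, \<open>*\<Omega>\<close> contains the monads of the points of \<open>\<Omega>\<close>; hence at nearstandard points
  the iterated differences of standard order only involve values of \<open>\<phi>\<close> on the grid, and the
  extension by \<open>0\<close> does not affect \<open>class_S_infinity\<close>.
\<close>

definition class_S_infinity ::
  "(real^'n::finite) set \<Rightarrow> (nat, 'i::nonstandard_index) star \<Rightarrow> ('n, 'i) internal_fun \<Rightarrow> bool"
  where
  "class_S_infinity \<Omega> N \<phi> \<longleftrightarrow> (\<forall>\<alpha>::'n \<Rightarrow> nat. class_S0 \<Omega> N (star_map2 (grid_diffs \<alpha>) N \<phi>))"

definition test_X ::
  "(real^'n::finite) set \<Rightarrow> (nat, 'i::nonstandard_index) star \<Rightarrow> ('n, 'i) internal_fun set" where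
  "test_X \<Omega> N = {\<phi> \<in> grid_functions \<Omega> N. class_S_infinity \<Omega> N \<phi> \<and>
    compactly_contained (std_part_set {x \<in> Omega_X \<Omega> N. star_app \<phi> x \<noteq> star_of 0}) \<Omega>}"

definition grid_distribution ::
  "(real^'n::finite) set \<Rightarrow> (nat, 'i::nonstandard_index) star \<Rightarrow> ('n, 'i) internal_fun \<Rightarrow> bool"
  where
  "grid_distribution \<Omega> N u \<longleftrightarrow> u \<in> grid_functions \<Omega> N \<and>
    (\<forall>\<phi>\<in>test_X \<Omega> N. star_finite (inner_X \<Omega> N u \<phi>))"

text \<open>
  \<open>class_is \<Omega> N u g\<close> is \<open>[u] = g\<close>; a standard real is the standard part of a hyperreal iff it is
  infinitely close to it.
\<close>

definition class_is ::
  "(real^'n::finite) set \<Rightarrow> (nat, 'i::nonstandard_index) star \<Rightarrow> ('n, 'i) internal_fun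
    \<Rightarrow> 'n L2 \<Rightarrow> bool" where
  "class_is \<Omega> N u g \<longleftrightarrow> grid_distribution \<Omega> N u \<and>
    (\<forall>\<phi>\<in>test_functions \<Omega>.
      inner_X \<Omega> N u (star_of \<phi>) \<approx> star_of (LINT x:\<Omega>|lebesgue. rep_L2 g x * \<phi> x))"

end

(* If u is infinitely close in norm to P( *g ), then so is F_X(u) to F_X(P( *g )).  As the restriction of
   a standard test function to the grid has finite norm, the Cauchy-Schwarz inequality shows that
   F_X(u) and F_X(P( *g )) represent the same distribution.  Hence f and F(g) agree as distributions,
   and therefore in L2 by the fundamental lemma of the calculus of variations.  That P( *f ) represents f
   holds because the step functions of a test function converge to it boundedly, with supports in a
   common compact set. *)

theory Submission
  imports Defs
begin

section \<open>Functions with vanishing integrals over boxes\<close>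

text \<open>The analytic limits are taken along standard grid sizes tending to infinity; nonstandard
  analysis enters only when such a limit is read at the infinite \<open>N\<close>. This suffices for
  pairings built from standard functions. For internal objects such as u and its image under
  \<open>FX\<close>, the estimate is made at one standard index: for each r > 0, finitely many
  conditions hold together on a set of the ultrafilter, and a point of that set supplies standard
  data.

  The test functions of an arbitrary open \<Omega> have to be numerous enough to separate elements
  of L2. Bumps on boxes are enough: their limits are indicators of boxes, boxes generate the Borel
  sets and are stable under intersection, and an open set is a countable union of boxes whose
  closures lie in it.

  From a solution v one gets the grid solution \<open>proj_X \<Omega> N v\<close> with right-hand
  side \<open>FX (proj_X \<Omega> N v)\<close>. That right-hand side represents f, but the
  hypotheses do not identify it with \<open>proj_X \<Omega> N f\<close>; hence the claim about the
  latter right-hand side is an implication towards v.\<close>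

lemma AE_zero_if_box_integrals_zero:
  fixes f :: "'a::euclidean_space \<Rightarrow> real"
  assumes f: "integrable lebesgue f"
    and zero: "\<And>a b. (LINT x:box a b|lebesgue. f x) = 0"
  shows "AE x in lebesgue. f x = 0"
proof -
  \<comment> \<open>Boxes generate only the Borel sets, while f is merely Lebesgue measurable; a
    Borel version is therefore used for the induction over sets.\<close>
  obtain g where g[measurable]: "g \<in> borel_measurable lborel" and fg: "AE x in lborel. f x = g x"
    using completion_ex_borel_measurable_real[OF borel_measurable_integrable[OF f]] by auto
  have fg': "AE x in lebesgue. f x = g x"
    using fg by (rule AE_completion)
  have "integrable lebesgue g"
    using integrable_cong_AE_imp[OF f measurable_completion[OF g]] fg' by (simp add: eq_commute)
  then have g_int: "integrable lborel g"
    by (simp add: integrable_completion)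
  have box: "(LINT x:box a b|lborel. g x) = 0" for a b
  proof -
    have "(LINT x:box a b|lborel. g x) = (LINT x:box a b|lebesgue. g x)"
      unfolding set_lebesgue_integral_def by (subst integral_completion) auto
    also have "\<dots> = (LINT x:box a b|lebesgue. f x)"
      unfolding set_lebesgue_integral_def
      using fg' borel_measurable_integrable[OF f] measurable_completion[OF g]
      by (intro integral_cong_AE borel_measurable_scaleR borel_measurable_indicator) auto
    finally show ?thesis
      using zero by simp
  qed
  have g_set: "set_integrable lborel A g" if "A \<in> sets lborel" for A
    unfolding set_integrable_def using g_int that by (rule integrable_mult_indicator[rotated])
  \<comment> \<open>The complement case below needs the integral over the whole space, which is no
    box but an increasing union of boxes.\<close>
  have "(\<lambda>n. LINT x:box (- (real n *\<^sub>R One)) (real n *\<^sub>R One)|lborel. g x)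
      \<longlonglongrightarrow> (LINT x:(\<Union>n::nat. box (- (real n *\<^sub>R One)) (real n *\<^sub>R One))|lborel. g x)"
  proof (rule set_integral_cont_up)
    show "incseq (\<lambda>n. box (- (real n *\<^sub>R One)) (real n *\<^sub>R One) :: 'a set)"
      by (rule incseq_SucI) (auto simp: mem_box algebra_simps, (smt (verit))+)
  qed (auto intro: g_set)
  then have UNIV_zero: "(LINT x|lborel. g x) = 0"
    unfolding box UN_box_eq_UNIV by (simp add: LIMSEQ_const_iff set_lebesgue_integral_def)
  have Int_st: "Int_stable (range (\<lambda>(a, b). box a b::'a set))"
    by (auto simp: Int_stable_def box_Int_box)
  have box_Pow: "range (\<lambda>(a, b). box a b::'a set) \<subseteq> Pow UNIV"
    by simp
  have A: "(LINT x:A|lborel. g x) = 0" if "A \<in> sets lborel" for A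
  proof -
    have "A \<in> sigma_sets UNIV (range (\<lambda>(a, b). box a b::'a set))"
      using that by (simp add: borel_eq_box)
    \<comment> \<open>Dynkin's argument: the sets over which g integrates to 0 are closed under
      complements and countable disjoint unions.\<close>
    from Int_st box_Pow this show ?thesis
    proof (induction rule: sigma_sets_induct_disjoint)
      case (compl A)
      then have "A \<in> sets lborel" by (simp add: borel_eq_box)
      then have "(LINT x:A \<union> (UNIV - A)|lborel. g x) =
          (LINT x:A|lborel. g x) + (LINT x:UNIV - A|lborel. g x)"
        by (intro set_integral_Un g_set) auto
      then show ?case
        using compl UNIV_zero by (simp add: set_lebesgue_integral_def)
    next
      case (union B)
      then have "range B \<subseteq> sets lborel" by (simp add: borel_eq_box)
      then have "(LINT x:(\<Union>i. B i)|lborel. g x) = (\<Sum>i. LINT x:B i|lborel. g x)"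
        using union(1) by (intro lebesgue_integral_countable_add g_set) (auto simp: disjoint_family_on_def)
      then show ?case
        using union by simp
    qed (auto simp: box set_lebesgue_integral_def[of _ "{}"])
  qed
  have "AE x in lborel. g x = 0"
    using g_int A by (rule sigma_finite_measure.density_zero[OF lborel.sigma_finite_measure_axioms])
  then have "AE x in lebesgue. g x = 0"
    by (rule AE_completion)
  with fg' show ?thesis
    by eventually_elim simp
qed

text \<open>Cutting f off to a box inside S reduces to the global case, because the intersection of
  two boxes is a box. Countably many boxes with rational corners then cover S. Only boxes whose
  closed cell lies in S are tested, since these are the ones that carry test functions on S.\<close>

lemma AE_zero_on_open_if_box_integrals_zero:
  fixes f :: "'a::euclidean_space \<Rightarrow> real"
  assumes "open S"
    and f: "\<And>a b. set_integrable lebesgue (cbox a b) f"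
    and zero: "\<And>a b. cbox a b \<subseteq> S \<Longrightarrow> (LINT x:box a b|lebesgue. f x) = 0"
  shows "AE x in lebesgue. x \<in> S \<longrightarrow> f x = 0"
proof -
  have cell: "AE x in lebesgue. x \<in> box c d \<longrightarrow> f x = 0" if cd: "cbox c d \<subseteq> S" for c d
  proof -
    have "integrable lebesgue (\<lambda>x. indicator (box c d) x *\<^sub>R f x)"
      using set_integrable_subset[OF f, of "box c d" c d]
      by (simp add: set_integrable_def box_subset_cbox)
    then have "AE x in lebesgue. indicator (box c d) x *\<^sub>R f x = 0"
    proof (rule AE_zero_if_box_integrals_zero)
      fix a b
      obtain e h where eh: "box a b \<inter> box c d = box e h"
        by (simp add: box_Int_box)
      have "(LINT x:box e h|lebesgue. f x) = 0"
      \<comment> \<open>An empty open box may have a nonempty degenerate \<open>cbox\<close> that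
        leaves S, so that \<open>zero\<close> would not apply to it.\<close>
      proof (cases "box e h = {}")
        case False
        have "box e h \<subseteq> box c d"
          using eh by blast
        then have "closure (box e h) \<subseteq> closure (box c d)"
          by (rule closure_mono)
        then have "cbox e h \<subseteq> cbox c d"
          using False eh by (simp add: closure_box) (metis Int_empty_right closure_box)
        with cd show ?thesis
          by (intro zero) auto
      qed (simp add: set_lebesgue_integral_def)
      then show "(LINT x:box a b|lebesgue. indicator (box c d) x *\<^sub>R f x) = 0"
        unfolding eh[symmetric]
        by (simp add: set_lebesgue_integral_def indicator_inter_arith ac_simps)
    qed
    then show ?thesis
      by eventually_elim (auto simp: indicator_def split: if_splits)
  qed
  define cells where "cells = {(c, d). cbox c d \<subseteq> S \<and> (\<forall>i\<in>Basis. c \<bullet> i \<in> \<rat> \<and> d \<bullet> i \<in> \<rat>)}"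
  let ?r = "\<lambda>p::'a \<Rightarrow> real. \<Sum>i\<in>Basis. p i *\<^sub>R i"
  have "cells \<subseteq> (\<lambda>(p, q). (?r p, ?r q)) ` ((Basis \<rightarrow>\<^sub>E \<rat>) \<times> (Basis \<rightarrow>\<^sub>E \<rat>))"
  proof (rule subsetI)
    fix cd assume "cd \<in> cells"
    then obtain c d where cd: "cd = (c, d)" "\<forall>i\<in>Basis. c \<bullet> i \<in> \<rat> \<and> d \<bullet> i \<in> \<rat>"
      by (auto simp: cells_def)
    then show "cd \<in> (\<lambda>(p, q). (?r p, ?r q)) ` ((Basis \<rightarrow>\<^sub>E \<rat>) \<times> (Basis \<rightarrow>\<^sub>E \<rat>))"
      by (intro image_eqI[where x = "(\<lambda>i\<in>Basis. c \<bullet> i, \<lambda>i\<in>Basis. d \<bullet> i)"])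
         (auto simp: euclidean_representation)
  qed
  then have "countable cells"
    by (rule countable_subset)
       (intro countable_image countable_SIGMA countable_PiE countable_rat finite_Basis)
  moreover have "AE x in lebesgue. x \<in> box (fst p) (snd p) \<longrightarrow> f x = 0" if "p \<in> cells" for p
    using that by (intro cell) (auto simp: cells_def)
  ultimately have "AE x in lebesgue. \<forall>p\<in>cells. x \<in> box (fst p) (snd p) \<longrightarrow> f x = 0"
    by (subst AE_ball_countable) auto
  then show ?thesis
  proof (rule AE_mp, intro AE_I2 impI)
    fix x assume *: "\<forall>p\<in>cells. x \<in> box (fst p) (snd p) \<longrightarrow> f x = 0" and "x \<in> S"
    then obtain e where e: "e > 0" "cball x e \<subseteq> S"
      using \<open>open S\<close> open_contains_cball by blast
    obtain c d where cd: "\<forall>i\<in>Basis. c \<bullet> i \<in> \<rat> \<and> d \<bullet> i \<in> \<rat>" "x \<in> box c d" "box c d \<subseteq> ball x e"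
      using rational_boxes[OF \<open>e > 0\<close>] by metis
    have "closure (box c d) \<subseteq> cball x e"
      using closure_mono[OF cd(3)] \<open>e > 0\<close> by simp
    then have "cbox c d \<subseteq> S"
      using cd(2) e closure_box[of c d] by blast
    then show "f x = 0"
      using * cd by (force simp: cells_def)
  qed
qed

section \<open>Smooth bump functions on boxes\<close>

text \<open>The classical flat function is the case n = 0. The powers in the denominator are
  included because differentiation then stays within linear combinations of the family.\<close>

definition flat_exp :: "nat \<Rightarrow> real \<Rightarrow> real" where
  "flat_exp n t = (if t \<le> 0 then 0 else exp (- (1 / t)) / t ^ n)"

text \<open>With s = 1/t this is the decay of s^n exp(-s) at infinity.\<close>

lemma flat_exp_at_right: "(flat_exp n \<longlongrightarrow> 0) (at_right 0)"
proof -
  have "((\<lambda>t. inverse t ^ n / exp (inverse t)) \<longlongrightarrow> 0) (at_right (0::real))"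
    by (rule filterlim_compose[OF tendsto_power_div_exp_0 filterlim_inverse_at_top_right])
  then show ?thesis
  proof (rule Lim_transform_eventually)
    show "\<forall>\<^sub>F t in at_right 0. inverse t ^ n / exp (inverse t) = flat_exp n t"
      using eventually_at_right_less[of "0::real"]
      by eventually_elim (simp add: flat_exp_def exp_minus field_simps)
  qed
qed

lemma flat_exp_tendsto_0: "(flat_exp n \<longlongrightarrow> 0) (at 0)"
proof -
  have "(flat_exp n \<longlongrightarrow> 0) (at_left 0)"
    by (rule tendsto_eventually)
       (use eventually_at_left_real[of "-1::real" 0] in \<open>auto elim: eventually_mono simp: flat_exp_def\<close>)
  with flat_exp_at_right show ?thesis
    by (simp add: filterlim_split_at)
qed

lemma flat_exp_has_derivative:
  "(flat_exp n has_real_derivative flat_exp (n + 2) t - real n * flat_exp (n + 1) t) (at t)"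
proof -
  consider "t < 0" | "t = 0" | "t > 0" by linarith
  then show ?thesis
  proof cases
    case 1
    have "((\<lambda>_. 0) has_real_derivative 0) (at t)" by simp
    then have "(flat_exp n has_real_derivative 0) (at t)"
      by (rule has_field_derivative_transform_within_open[of _ _ _ "{..<0}"])
         (use 1 in \<open>auto simp: flat_exp_def\<close>)
    with 1 show ?thesis by (simp add: flat_exp_def)
  next
    case 2
    \<comment> \<open>Away from h = 0 the difference quotient at 0 is exactly
      \<open>flat_exp (Suc n) h\<close>, so the preceding limit settles the critical point.\<close>
    have "((\<lambda>h. (flat_exp n (0 + h) - flat_exp n 0) / h) \<longlongrightarrow> 0) (at 0)"
      using flat_exp_tendsto_0[of "Suc n"]
      by (rule Lim_transform_eventually)
         (auto simp: eventually_at_filter flat_exp_def)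
    with 2 show ?thesis by (simp add: DERIV_def flat_exp_def)
  next
    case 3
    have "((\<lambda>t. exp (- (1 / t)) / t ^ n) has_real_derivative
        flat_exp (n + 2) t - real n * flat_exp (n + 1) t) (at t)"
    proof (rule DERIV_cong)
      show "((\<lambda>t. exp (- (1 / t)) / t ^ n) has_real_derivative
          (exp (- (1 / t)) * (1 / t\<^sup>2) * t ^ n - exp (- (1 / t)) * (real n * t ^ (n - Suc 0)))
          / (t ^ n * t ^ n)) (at t)"
        using 3 by (auto intro!: derivative_eq_intros simp: power2_eq_square)
      show "(exp (- (1 / t)) * (1 / t\<^sup>2) * t ^ n - exp (- (1 / t)) * (real n * t ^ (n - Suc 0)))
          / (t ^ n * t ^ n) = flat_exp (n + 2) t - real n * flat_exp (n + 1) t"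
        using 3 by (cases n) (auto simp: flat_exp_def field_simps power2_eq_square)
    qed
    then show ?thesis
      by (rule has_field_derivative_transform_within_open[of _ _ _ "{0<..}"])
         (use 3 in \<open>auto simp: flat_exp_def\<close>)
  qed
qed

text \<open>An algebra of functions that is closed under partial derivatives, hence consists of smooth functions.\<close>

inductive flat_exp_poly :: "(real^'n::finite \<Rightarrow> real) \<Rightarrow> bool" where
  const: "flat_exp_poly (\<lambda>_. c)"
| flat: "flat_exp_poly (\<lambda>x. flat_exp n (c * x $ i + d))"
| add: "flat_exp_poly p \<Longrightarrow> flat_exp_poly q \<Longrightarrow> flat_exp_poly (\<lambda>x. p x + q x)"
| mult: "flat_exp_poly p \<Longrightarrow> flat_exp_poly q \<Longrightarrow> flat_exp_poly (\<lambda>x. p x * q x)"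

text \<open>Differentiability and membership of the partial derivatives in the algebra are proved
  together, since the product rule for the latter involves both factors and their partial
  derivatives.\<close>

lemma flat_exp_poly_has_derivative:
  assumes "flat_exp_poly (p :: real^'n::finite \<Rightarrow> real)"
  shows "\<exists>D. (\<forall>i. flat_exp_poly (D i)) \<and>
    (\<forall>x. (p has_derivative (\<lambda>v. \<Sum>i\<in>UNIV. D i x * v $ i)) (at x))"
  using assms
proof induction
  case (const c)
  show ?case
    by (rule exI[of _ "\<lambda>_ _. 0"]) (auto intro: flat_exp_poly.const)
next
  case (flat n c i d)
  \<comment> \<open>The chain rule contributes the factor c. The difference is written with
    \<open>+ -\<close> so that it matches the constructors of the algebra.\<close>
  define q :: "real^'n \<Rightarrow> real" where
    "q x = c * (flat_exp (n + 2) (c * x $ i + d) + - real n * flat_exp (n + 1) (c * x $ i + d))" for x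
  have q: "flat_exp_poly q"
    unfolding q_def by (intro flat_exp_poly.intros)
  show ?case
  proof (intro exI[of _ "\<lambda>j. if j = i then q else (\<lambda>_. 0)"] conjI allI)
    fix x :: "real^'n"
    have lin: "((\<lambda>x. c * x $ i + d) has_derivative (\<lambda>v. c * v $ i)) (at x)"
      by (auto intro!: derivative_eq_intros bounded_linear.has_derivative[OF bounded_linear_vec_nth])
    have "(\<Sum>j\<in>UNIV. (if j = i then q else (\<lambda>_. 0)) x * v $ j) =
        (\<Sum>j\<in>UNIV. if j = i then q x * v $ j else 0)" for v
      by (rule sum.cong) auto
    then have sum_eq: "(\<Sum>j\<in>UNIV. (if j = i then q else (\<lambda>_. 0)) x * v $ j) = q x * v $ i" for v
      by simp
    show "((\<lambda>x. flat_exp n (c * x $ i + d)) has_derivative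
        (\<lambda>v. \<Sum>j\<in>UNIV. (if j = i then q else (\<lambda>_. 0)) x * v $ j)) (at x)"
      unfolding sum_eq
      using has_derivative_compose[OF lin
          flat_exp_has_derivative[of n "c * x $ i + d", unfolded has_field_derivative_def]]
      by (rule has_derivative_eq_rhs) (auto simp: q_def algebra_simps)
  qed (auto intro: q flat_exp_poly.const)
next
  case (add p q)
  then obtain P Q where P: "\<And>i. flat_exp_poly (P i)" "\<And>i. flat_exp_poly (Q i)"
    "\<And>x. (p has_derivative (\<lambda>v. \<Sum>i\<in>UNIV. P i x * v $ i)) (at x)"
    "\<And>x. (q has_derivative (\<lambda>v. \<Sum>i\<in>UNIV. Q i x * v $ i)) (at x)"
    by blast
  show ?case
  proof (intro exI[of _ "\<lambda>i x. P i x + Q i x"] conjI allI)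
    show "flat_exp_poly (\<lambda>x. P i x + Q i x)" for i
      by (intro flat_exp_poly.add P(1,2))
    show "((\<lambda>x. p x + q x) has_derivative (\<lambda>v. \<Sum>i\<in>UNIV. (P i x + Q i x) * v $ i)) (at x)" for x
      by (rule has_derivative_eq_rhs[OF has_derivative_add[OF P(3,4)]])
         (simp add: distrib_right sum.distrib)
  qed
next
  case (mult p q)
  then obtain P Q where P: "\<And>i. flat_exp_poly (P i)" "\<And>i. flat_exp_poly (Q i)"
    "\<And>x. (p has_derivative (\<lambda>v. \<Sum>i\<in>UNIV. P i x * v $ i)) (at x)"
    "\<And>x. (q has_derivative (\<lambda>v. \<Sum>i\<in>UNIV. Q i x * v $ i)) (at x)"
    by blast
  show ?case
  proof (intro exI[of _ "\<lambda>i x. p x * Q i x + P i x * q x"] conjI allI)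
    show "flat_exp_poly (\<lambda>x. p x * Q i x + P i x * q x)" for i
      by (intro flat_exp_poly.add flat_exp_poly.mult P(1,2) mult.hyps)
    show "((\<lambda>x. p x * q x) has_derivative
        (\<lambda>v. \<Sum>i\<in>UNIV. (p x * Q i x + P i x * q x) * v $ i)) (at x)" for x
      by (rule has_derivative_eq_rhs[OF has_derivative_mult[OF P(3,4)]])
         (simp add: algebra_simps sum.distrib sum_distrib_left)
  qed
qed

lemma flat_exp_poly_partial_deriv:
  assumes "flat_exp_poly (p :: real^'n::finite \<Rightarrow> real)"
  shows "flat_exp_poly (partial_deriv i p)"
proof -
  obtain D where D: "\<And>i. flat_exp_poly (D i)"
    and p: "\<And>x. (p has_derivative (\<lambda>v. \<Sum>i\<in>UNIV. D i x * v $ i)) (at x)"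
    using flat_exp_poly_has_derivative[OF assms] by blast
  have "partial_deriv i p = D i"
    by (simp add: partial_deriv_def fun_eq_iff frechet_derivative_at[OF p, symmetric] axis_def
        if_distrib[of "\<lambda>y. _ * y"] cong: if_cong)
  with D show ?thesis by simp
qed

lemma flat_exp_poly_smooth:
  assumes "flat_exp_poly (p :: real^'n::finite \<Rightarrow> real)"
  shows "smooth p"
  unfolding smooth_def
proof (intro allI)
  fix js :: "'n list" and x
  have "flat_exp_poly (partial_derivs js p)"
    using assms by (induction js) (auto simp: partial_derivs_def flat_exp_poly_partial_deriv)
  then show "partial_derivs js p differentiable (at x)"
    using flat_exp_poly_has_derivative unfolding differentiable_def by blast
qed

lemma smooth_imp_continuous:
  assumes "smooth \<phi>"
  shows "continuous_on UNIV \<phi>"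
proof -
  have "\<phi> differentiable (at x)" for x
    using assms[unfolded smooth_def partial_derivs_def, rule_format, of "[]"] by simp
  then show ?thesis
    by (simp add: continuous_at_imp_continuous_on differentiable_imp_continuous_within)
qed

section \<open>Product bumps supported on a box\<close>

lemma flat_exp_poly_prod:
  "finite A \<Longrightarrow> (\<And>i. i \<in> A \<Longrightarrow> flat_exp_poly (p i)) \<Longrightarrow> flat_exp_poly (\<lambda>x. \<Prod>i\<in>A. p i x)"
  by (induction A rule: finite_induct) (auto intro: flat_exp_poly.intros)

text \<open>
  Replacing \<open>t\<close> by \<open>(m + 1) t\<close> in \<open>exp (- 1 / t)\<close> amounts to taking the \<open>(m + 1)\<close>-st root; hence
  the bumps converge to the indicator function of the box, all of them having the box as support.
\<close>

definition box_bump :: "real^'n::finite \<Rightarrow> real^'n \<Rightarrow> nat \<Rightarrow> real^'n \<Rightarrow> real" where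
  "box_bump a b m x = (\<Prod>i\<in>UNIV.
    flat_exp 0 (real (Suc m) * x $ i + - real (Suc m) * a $ i) *
    flat_exp 0 (- real (Suc m) * x $ i + real (Suc m) * b $ i))"

lemma box_bump_smooth: "smooth (box_bump a b m)"
  unfolding box_bump_def
  by (intro flat_exp_poly_smooth flat_exp_poly_prod flat_exp_poly.mult flat_exp_poly.flat finite)

lemma flat_exp_0_bounds: "0 \<le> flat_exp 0 t" "flat_exp 0 t \<le> 1"
  by (auto simp: flat_exp_def)

lemma box_bump_bounds: "0 \<le> box_bump a b m x" "box_bump a b m x \<le> 1"
  unfolding box_bump_def
  by (auto intro!: prod_nonneg prod_le_1 mult_nonneg_nonneg mult_le_one flat_exp_0_bounds)

lemma box_bump_eq_0_iff: "box_bump a b m x = 0 \<longleftrightarrow> x \<notin> box a b"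
proof -
  have "flat_exp 0 (real (Suc m) * s + - real (Suc m) * t) = 0 \<longleftrightarrow> s \<le> t" for s t
  proof -
    have "real (Suc m) * s + - real (Suc m) * t = real (Suc m) * (s - t)"
      by (simp add: algebra_simps)
    also have "\<dots> \<le> 0 \<longleftrightarrow> s \<le> t"
      by (simp add: mult_le_0_iff)
    finally show ?thesis by (simp add: flat_exp_def)
  qed
  note 1 = this
  have 2: "flat_exp 0 (- real (Suc m) * s + real (Suc m) * t) = 0 \<longleftrightarrow> t \<le> s" for s t
    using 1[of t s] by (simp only: add.commute)
  show ?thesis
    unfolding box_bump_def prod_zero_iff[OF finite] mult_eq_0_iff 1 2
    by (auto simp: mem_box_cart not_less)
qed

lemma box_bump_test_function:
  assumes "cbox a b \<subseteq> \<Omega>"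
  shows "box_bump a b m \<in> test_functions \<Omega>"
proof -
  have "{x. box_bump a b m x \<noteq> 0} = box a b"
    by (simp add: box_bump_eq_0_iff)
  moreover have "closure (box a b) \<subseteq> cbox a b"
    by (intro closure_minimal box_subset_cbox closed_cbox)
  ultimately show ?thesis
    using assms box_bump_smooth by (auto simp: test_functions_def compactly_contained_def)
qed

lemma flat_exp_0_tendsto_1:
  assumes "t > 0"
  shows "(\<lambda>m. flat_exp 0 (real (Suc m) * t)) \<longlonglongrightarrow> 1"
proof -
  have "(\<lambda>m. exp (- (inverse t * inverse (real (Suc m))))) \<longlonglongrightarrow> exp (- (inverse t * 0))"
    by (intro tendsto_intros LIMSEQ_inverse_real_of_nat)
  moreover have "flat_exp 0 (real (Suc m) * t) = exp (- (inverse t * inverse (real (Suc m))))" for m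
    using assms by (auto simp: flat_exp_def divide_simps mult_le_0_iff)
  ultimately show ?thesis by simp
qed

lemma box_bump_tendsto: "(\<lambda>m. box_bump a b m x) \<longlonglongrightarrow> indicator (box a b) x"
proof (cases "x \<in> box a b")
  case True
  have "(\<lambda>m. \<Prod>i\<in>UNIV. flat_exp 0 (real (Suc m) * (x $ i - a $ i)) * flat_exp 0 (real (Suc m) * (b $ i - x $ i)))
      \<longlonglongrightarrow> (\<Prod>i\<in>(UNIV::'a set). 1 * 1)"
    using True by (intro tendsto_prod tendsto_mult flat_exp_0_tendsto_1) (auto simp: mem_box_cart)
  moreover have "box_bump a b m x = (\<Prod>i\<in>UNIV.
      flat_exp 0 (real (Suc m) * (x $ i - a $ i)) * flat_exp 0 (real (Suc m) * (b $ i - x $ i)))" for m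
    unfolding box_bump_def
    by (intro prod.cong arg_cong2[where f = "(*)"] arg_cong[where f = "flat_exp 0"] refl)
       (simp_all add: algebra_simps)
  ultimately show ?thesis
    using True by simp
next
  case False
  then have "box_bump a b m x = 0" for m
    by (simp add: box_bump_eq_0_iff)
  with False show ?thesis by simp
qed

section \<open>The fundamental lemma of the calculus of variations\<close>

text \<open>Dominated convergence with majorant B |f| on K. As f is integrable on K only, it is cut
  off there first; the common support makes this invisible. It serves both for the bumps and for the
  step functions of a test function.\<close>

lemma tendsto_integral_bounded_support:
  fixes f t :: "'a::euclidean_space \<Rightarrow> real"
  assumes f: "set_integrable lebesgue K f"
    and s[measurable]: "\<And>m::nat. s m \<in> borel_measurable lebesgue"
    and bound: "\<And>m x. \<bar>s m x\<bar> \<le> B"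
    and supp: "\<And>m x. x \<notin> K \<Longrightarrow> s m x = 0"
    and lim: "\<And>x. (\<lambda>m. s m x) \<longlonglongrightarrow> t x"
  shows "(\<lambda>m. LINT x|lebesgue. f x * s m x) \<longlonglongrightarrow> (LINT x|lebesgue. f x * t x)"
proof -
  define g where "g x = indicator K x * f x" for x
  have g: "integrable lebesgue g"
    using f by (simp add: set_integrable_def g_def[abs_def])
  then have [measurable]: "g \<in> borel_measurable lebesgue"
    by simp
  have [measurable]: "t \<in> borel_measurable lebesgue"
    by (rule borel_measurable_LIMSEQ_real[OF lim s])
  have "(\<lambda>m. LINT x|lebesgue. g x * s m x) \<longlonglongrightarrow> (LINT x|lebesgue. g x * t x)"
  proof (rule integral_dominated_convergence[where w = "\<lambda>x. \<bar>g x\<bar> * B"])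
    show "integrable lebesgue (\<lambda>x. \<bar>g x\<bar> * B)"
      using g by simp
    show "AE x in lebesgue. (\<lambda>m. g x * s m x) \<longlonglongrightarrow> g x * t x"
      by (intro AE_I2 tendsto_intros lim)
    show "AE x in lebesgue. norm (g x * s m x) \<le> \<bar>g x\<bar> * B" for m
      using bound by (auto simp: abs_mult intro!: mult_left_mono)
  qed measurable
  moreover have "g x * s m x = f x * s m x" for m x
    using supp[of x] by (auto simp: g_def indicator_def)
  moreover have "g x * t x = f x * t x" for x
  proof (cases "x \<in> K")
    case False
    then have "t x = 0"
      using lim[of x] supp[of x] by (simp add: LIMSEQ_const_iff)
    then show ?thesis by simp
  qed (simp add: g_def)
  ultimately show ?thesis by simp
qed

text \<open>On a set of finite measure, 1 + f^2 is an integrable majorant of |f|.\<close>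

lemma square_integrable_imp_set_integrable:
  assumes "square_integrable f" "S \<in> lmeasurable"
  shows "set_integrable lebesgue S f"
proof -
  have S: "S \<in> sets lebesgue" and f: "f \<in> borel_measurable lebesgue"
    using assms by (auto simp: square_integrable_def)
  have "set_integrable lebesgue S (\<lambda>x. 1 + (f x)\<^sup>2)"
  proof (rule set_integral_add)
    show "set_integrable lebesgue S (\<lambda>_. 1)"
      using assms(2) S by (simp add: set_integrable_def fmeasurable_def)
    show "set_integrable lebesgue S (\<lambda>x. (f x)\<^sup>2)"
      using assms(1) S unfolding set_integrable_def square_integrable_def
      by (intro integrable_mult_indicator) auto
  qed
  then show ?thesis
  proof (rule set_integrable_bound)
    show "set_borel_measurable lebesgue S f"
      using f S unfolding set_borel_measurable_def
      by (intro borel_measurable_scaleR borel_measurable_indicator)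
    have "\<bar>f x\<bar> \<le> 1 + (f x)\<^sup>2" for x
      using sum_squares_bound[of "\<bar>f x\<bar>" 1] abs_ge_zero[of "f x"]
      by (simp only: power2_abs power_one mult_1_right)
    then show "AE x in lebesgue. x \<in> S \<longrightarrow> norm (f x) \<le> norm (1 + (f x)\<^sup>2)"
      by (intro AE_I2) (smt (verit) real_norm_def zero_le_power2)
  qed
qed

lemma square_integrable_rep_L2: "square_integrable (rep_L2 g)"
  using Quotient3_rep_reflp[OF Quotient3_L2, of g] by (simp add: L2_eq_def)

lemma L2_eqI: "(AE x in lebesgue. rep_L2 g x = rep_L2 h x) \<Longrightarrow> g = h"
  using Quotient3_rel_rep[OF Quotient3_L2, of g h] by (simp add: L2_eq_def square_integrable_rep_L2)

lemma set_integral_test_function: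
  assumes "{x. \<phi> x \<noteq> 0} \<subseteq> \<Omega>"
  shows "(LINT x:\<Omega>|M. g x * (\<phi> x :: real)) = (LINT x|M. g x * \<phi> x)"
  unfolding set_lebesgue_integral_def
  by (rule Bochner_Integration.integral_cong) (use assms in \<open>auto simp: indicator_def\<close>)

lemma test_function_support: "\<phi> \<in> test_functions \<Omega> \<Longrightarrow> {x. \<phi> x \<noteq> 0} \<subseteq> \<Omega>"
  using closure_subset by (fastforce simp: test_functions_def compactly_contained_def)

text \<open>Testing with bumps and passing to the limit gives equal integrals over every box with
  closed cell in \<Omega>, hence equality almost everywhere on \<Omega>. Outside \<Omega> both
  representatives vanish almost everywhere by \<open>L2_on\<close>.\<close>

lemma L2_eq_if_test_integrals_eq:
  assumes "open \<Omega>" and gh: "g \<in> L2_on \<Omega>" "h \<in> L2_on \<Omega>"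
    and eq: "\<And>\<phi>. \<phi> \<in> test_functions \<Omega> \<Longrightarrow>
      (LINT x:\<Omega>|lebesgue. rep_L2 g x * \<phi> x) = (LINT x:\<Omega>|lebesgue. rep_L2 h x * \<phi> x)"
  shows "g = h"
proof -
  have int: "set_integrable lebesgue (cbox a b) (rep_L2 k)" for a b k
    by (intro square_integrable_imp_set_integrable square_integrable_rep_L2 lmeasurable_cbox)
  have lim: "(\<lambda>m. LINT x|lebesgue. rep_L2 k x * box_bump a b m x) \<longlonglongrightarrow>
      (LINT x|lebesgue. rep_L2 k x * indicator (box a b) x)" for k a b
  proof (rule tendsto_integral_bounded_support[OF int[of a b], where B = 1])
    show "box_bump a b m \<in> borel_measurable lebesgue" for m
      by (simp add: borel_measurable_continuous_onI measurable_completion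
          smooth_imp_continuous box_bump_smooth)
    show "\<bar>box_bump a b m x\<bar> \<le> 1" for m x
      using box_bump_bounds[of a b m x] by simp
    show "box_bump a b m x = 0" if "x \<notin> cbox a b" for m x
      using that box_subset_cbox[of a b] by (auto simp: box_bump_eq_0_iff)
  qed (rule box_bump_tendsto)
  have box_eq: "(LINT x:box a b|lebesgue. rep_L2 g x) = (LINT x:box a b|lebesgue. rep_L2 h x)"
    if "cbox a b \<subseteq> \<Omega>" for a b
  proof -
    have test: "box_bump a b m \<in> test_functions \<Omega>" for m
      using that by (rule box_bump_test_function)
    have "(LINT x|lebesgue. rep_L2 g x * box_bump a b m x) =
        (LINT x|lebesgue. rep_L2 h x * box_bump a b m x)" for m
      using eq[OF test] by (simp add: set_integral_test_function[OF test_function_support[OF test]])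
    then show ?thesis
      using LIMSEQ_unique[OF lim[of g a b], of "LINT x|lebesgue. rep_L2 h x * indicator (box a b) x"]
        lim[of h a b]
      by (simp add: set_lebesgue_integral_def mult.commute)
  qed
  have "AE x in lebesgue. x \<in> \<Omega> \<longrightarrow> rep_L2 g x - rep_L2 h x = 0"
  proof (rule AE_zero_on_open_if_box_integrals_zero[OF \<open>open \<Omega>\<close>])
    show "set_integrable lebesgue (cbox a b) (\<lambda>x. rep_L2 g x - rep_L2 h x)" for a b
      by (intro set_integral_diff int)
    show "(LINT x:box a b|lebesgue. rep_L2 g x - rep_L2 h x) = 0" if "cbox a b \<subseteq> \<Omega>" for a b
    proof -
      have "set_integrable lebesgue (box a b) (rep_L2 k)" for k
        by (intro square_integrable_imp_set_integrable square_integrable_rep_L2 lmeasurable_box)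
      then show ?thesis
        using box_eq[OF that] by (simp add: set_integral_diff)
    qed
  qed
  moreover have "AE x in lebesgue. x \<notin> \<Omega> \<longrightarrow> rep_L2 g x = 0" "AE x in lebesgue. x \<notin> \<Omega> \<longrightarrow> rep_L2 h x = 0"
    using gh by (auto simp: L2_on_def)
  ultimately have "AE x in lebesgue. rep_L2 g x = rep_L2 h x"
    by eventually_elim auto
  then show ?thesis
    by (rule L2_eqI)
qed

section \<open>Step functions and the grid projection\<close>

text \<open>The only possible corner of a grid cube containing z. Rounding goes down because the
  cubes contain their lower faces. It turns the sum in \<open>step_fun\<close> into a single
  evaluation.\<close>

definition corner :: "nat \<Rightarrow> real^'n::finite \<Rightarrow> real^'n" where
  "corner N z = (\<chi> i. real_of_int \<lfloor>real N * z $ i\<rfloor> / real N)"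

lemma mem_cube_iff_corner:
  assumes "N > 0" and y: "\<forall>i. y $ i \<in> grid N"
  shows "z \<in> cube N y \<longleftrightarrow> y = corner N z"
proof -
  have "y $ i \<le> z $ i \<and> z $ i < y $ i + 1 / real N \<longleftrightarrow> y $ i = corner N z $ i" for i
  proof -
    obtain n :: int where n: "y $ i = real_of_int n / real N"
      using y[rule_format, of i] by (auto simp: grid_def)
    have "y $ i \<le> z $ i \<and> z $ i < y $ i + 1 / real N \<longleftrightarrow>
        real_of_int n \<le> real N * z $ i \<and> real N * z $ i < real_of_int n + 1"
      using \<open>N > 0\<close> by (simp add: n field_simps)
    also have "\<dots> \<longleftrightarrow> \<lfloor>real N * z $ i\<rfloor> = n"
      by (auto simp: floor_eq_iff)
    also have "\<dots> \<longleftrightarrow> y $ i = corner N z $ i"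
      using \<open>N > 0\<close> by (auto simp: n corner_def)
    finally show ?thesis .
  qed
  then show ?thesis
    by (simp add: cube_def vec_eq_iff)
qed

lemma corner_dist:
  assumes "N > 0"
  shows "\<bar>corner N z $ i - z $ i\<bar> \<le> 1 / real N"
proof -
  have "corner N z $ i - z $ i = (of_int \<lfloor>real N * z $ i\<rfloor> - real N * z $ i) / real N"
    using assms by (simp add: corner_def field_simps)
  moreover have "\<bar>of_int \<lfloor>real N * z $ i\<rfloor> - real N * z $ i\<bar> \<le> 1"
    by linarith
  ultimately show ?thesis
    using assms by (simp add: abs_divide divide_right_mono)
qed

lemma corner_tendsto: "(\<lambda>N. corner N z) \<longlonglongrightarrow> z"
proof (rule vec_tendstoI)
  fix i
  have "(\<lambda>N. corner N z $ i - z $ i) \<longlonglongrightarrow> 0"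
  proof (rule Lim_null_comparison[OF _ lim_const_over_n[of 1]])
    show "\<forall>\<^sub>F N in sequentially. norm (corner N z $ i - z $ i) \<le> 1 / real N"
      using eventually_gt_at_top[of 0] by eventually_elim (simp add: corner_dist)
  qed
  then show "(\<lambda>N. corner N z $ i) \<longlonglongrightarrow> z $ i"
    by (rule LIM_zero_cancel)
qed

text \<open>Crude but uniform in N: it places the supports of all step functions of one test
  function in a common ball.\<close>

lemma corner_norm_diff:
  fixes z :: "real^'n::finite"
  assumes "N > 0"
  shows "norm (corner N z - z) \<le> real CARD('n)"
proof -
  have "norm (corner N z - z) \<le> (\<Sum>i\<in>UNIV. \<bar>(corner N z - z) $ i\<bar>)"
    by (rule norm_le_l1_cart)
  also have "\<dots> \<le> (\<Sum>i\<in>(UNIV::'n set). 1)"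
  proof (rule sum_mono)
    fix i
    have "1 / real N \<le> 1" using assms by simp
    then show "\<bar>(corner N z - z) $ i\<bar> \<le> 1"
      using corner_dist[OF assms, of z i] by simp
  qed
  finally show ?thesis by simp
qed

text \<open>The grid reaches from -N to N. Rounding changes the numerator by at most 1, while the
  unit margin in the hypothesis leaves room for N.\<close>

lemma corner_in_grid:
  assumes "real N \<ge> \<bar>z $ i\<bar> + 1"
  shows "corner N z $ i \<in> grid N"
proof -
  have N: "real N > 0" using assms by linarith
  have "real N * \<bar>z $ i\<bar> \<le> real N * (real N - 1)"
    using assms N by (intro mult_left_mono) auto
  then have "\<bar>real N * z $ i\<bar> \<le> (real N)\<^sup>2 - real N"
    using N by (simp add: abs_mult algebra_simps power2_eq_square)
  moreover have "real N \<ge> 1" using assms by linarith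
  ultimately have "\<bar>real_of_int \<lfloor>real N * z $ i\<rfloor>\<bar> \<le> (real N)\<^sup>2"
    by linarith
  then have "\<bar>real_of_int \<lfloor>real N * z $ i\<rfloor>\<bar> \<le> real_of_int ((int N)\<^sup>2)"
    by simp
  then have "\<bar>\<lfloor>real N * z $ i\<rfloor>\<bar> \<le> (int N)\<^sup>2"
    by linarith
  then show ?thesis
    unfolding grid_def corner_def by (intro CollectI exI[of _ "\<lfloor>real N * z $ i\<rfloor>"]) (auto simp: abs_le_iff)
qed

lemma finite_domain_grid: "finite (domain_grid \<Omega> N :: (real^'n::finite) set)"
proof (rule finite_subset)
  have "grid N = (\<lambda>n. real_of_int n * (1 / real N)) ` {- (int N)\<^sup>2..(int N)\<^sup>2}"
    by (auto simp: grid_def)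
  then have "finite ((\<lambda>f. \<chi> i. f i) ` (UNIV \<rightarrow>\<^sub>E grid N) :: (real^'n) set)"
    by (intro finite_imageI finite_PiE) auto
  moreover have "{x::real^'n. \<forall>i. x $ i \<in> grid N} \<subseteq> (\<lambda>f. \<chi> i. f i) ` (UNIV \<rightarrow>\<^sub>E grid N)"
    by (auto intro!: image_eqI[where x = "($) _"])
  ultimately show "finite {x::real^'n. \<forall>i. x $ i \<in> grid N}"
    by (rule finite_subset[rotated])
qed (auto simp: domain_grid_def)

lemma step_fun_eq:
  assumes "N > 0"
  shows "step_fun \<Omega> N \<phi> z = (if corner N z \<in> domain_grid \<Omega> N then \<phi> (corner N z) else 0)"
proof -
  have "step_fun \<Omega> N \<phi> z = (\<Sum>y\<in>domain_grid \<Omega> N. if y = corner N z then \<phi> y else 0)"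
    unfolding step_fun_def
  proof (rule sum.cong)
    fix y :: "real^'a" assume "y \<in> domain_grid \<Omega> N"
    then have "z \<in> cube N y \<longleftrightarrow> y = corner N z"
      using assms by (intro mem_cube_iff_corner) (auto simp: domain_grid_def)
    then show "\<phi> y * indicator (cube N y) z = (if y = corner N z then \<phi> y else 0)"
      by (simp add: indicator_def)
  qed simp
  then show ?thesis
    by (simp add: finite_domain_grid)
qed

text \<open>Division by zero gives cubes of side 0, which are empty as they are half-open. So the
  uniform bounds below hold for every N, as dominated convergence requires.\<close>

lemma step_fun_0: "step_fun \<Omega> 0 \<phi> z = 0"
  by (simp add: step_fun_def cube_def)

section \<open>Measurability and measure of the grid cubes\<close>

lemma cube_bounds: "box y (\<chi> i. y $ i + 1 / real N) \<subseteq> cube N y"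
  "cube N y \<subseteq> cbox y (\<chi> i. y $ i + 1 / real N)"
  by (auto simp: cube_def mem_box_cart less_imp_le)

lemma cube_borel: "cube N (y :: real^'n::finite) \<in> sets borel"
proof -
  have "cube N y = (\<Inter>i\<in>UNIV. {z. y $ i \<le> z $ i} \<inter> {z. z $ i < y $ i + 1 / real N})"
    by (auto simp: cube_def)
  also have "\<dots> \<in> sets borel"
    by (intro sets.finite_INT sets.Int borel_closed borel_open closed_halfspace_component_ge_cart
        open_halfspace_component_lt_cart) auto
  finally show ?thesis .
qed

lemma cube_lmeasurable: "cube N (y :: real^'n::finite) \<in> lmeasurable"
  by (intro bounded_set_imp_lmeasurable bounded_subset[OF bounded_cbox cube_bounds(2)]
      sets_completionI_sets) (simp add: cube_borel)

lemma integrable_indicator_cube: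
  "integrable lebesgue (indicator (cube N (y :: real^'n::finite)) :: _ \<Rightarrow> real)"
  using cube_lmeasurable[of N y] by (simp add: lmeasurable_iff_integrable)

text \<open>The half-open cube is squeezed between an open and a closed box of equal
  measure.\<close>

lemma measure_cube: "measure lebesgue (cube N (y :: real^'n::finite)) = (1 / real N) ^ CARD('n)"
proof -
  let ?b = "\<chi> i. y $ i + 1 / real N"
  have "measure lebesgue (box y ?b) = measure lebesgue (cbox y ?b)"
    by (simp add: measure_lborel_box_eq measure_lborel_cbox_eq)
  moreover have "measure lebesgue (cbox y ?b) = (1 / real N) ^ CARD('n)"
  proof -
    have "cbox y ?b \<noteq> {}" by (simp add: interval_eq_empty_cart not_less)
    then show ?thesis using content_cbox_cart[of y ?b] by simp
  qed
  moreover have "measure lebesgue (box y ?b) \<le> measure lebesgue (cube N y)"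
    by (intro measure_mono_fmeasurable cube_bounds cube_lmeasurable) auto
  moreover have "measure lebesgue (cube N y) \<le> measure lebesgue (cbox y ?b)"
    by (intro measure_mono_fmeasurable cube_bounds fmeasurableD cube_lmeasurable) auto
  ultimately show ?thesis by simp
qed

section \<open>Approximation by step functions\<close>

lemma step_fun_borel: "step_fun \<Omega> N \<phi> \<in> borel_measurable borel"
  unfolding step_fun_def[abs_def]
  by (intro borel_measurable_sum borel_measurable_times borel_measurable_const
      borel_measurable_indicator cube_borel)

lemma step_fun_lebesgue: "step_fun \<Omega> N \<phi> \<in> borel_measurable lebesgue"
  using step_fun_borel[of \<Omega> N \<phi>] by (intro measurable_completion) simp

lemma step_fun_nonzero_imp_domain_hat:
  assumes "step_fun \<Omega> N \<phi> z \<noteq> 0"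
  shows "z \<in> domain_hat \<Omega> N"
proof -
  have "N > 0"
    using assms step_fun_0 by (metis neq0_conv)
  with assms show ?thesis
    by (auto simp: domain_hat_def step_fun_eq split: if_splits)
qed

text \<open>This removes a domain of integration that varies with N.\<close>

lemma set_integral_domain_hat:
  "(LINT z:domain_hat \<Omega> N|lebesgue. g z * step_fun \<Omega> N \<phi> z) = (LINT z|lebesgue. g z * step_fun \<Omega> N \<phi> z)"
  by (rule set_integral_test_function) (use step_fun_nonzero_imp_domain_hat in blast)

text \<open>For large N the rounded point has grid coordinates. It may still lie outside \<Omega>,
  but there \<phi> is 0 and so is the step function; in either case the value is \<phi> at the
  rounded point.\<close>

lemma step_fun_tendsto:
  assumes cont: "continuous_on UNIV \<phi>" and supp: "{x. \<phi> x \<noteq> 0} \<subseteq> \<Omega>"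
  shows "(\<lambda>N. step_fun \<Omega> N \<phi> z) \<longlonglongrightarrow> \<phi> z"
proof (rule Lim_transform_eventually)
  show "(\<lambda>N. \<phi> (corner N z)) \<longlonglongrightarrow> \<phi> z"
    by (rule continuous_on_tendsto_compose[OF cont corner_tendsto]) auto
  have "\<forall>\<^sub>F N in sequentially. \<forall>i. real N \<ge> \<bar>z $ i\<bar> + 1"
    by (intro eventually_all_finite filterlim_real_sequentially[THEN filterlim_at_top[THEN iffD1], rule_format])
  then show "\<forall>\<^sub>F N in sequentially. \<phi> (corner N z) = step_fun \<Omega> N \<phi> z"
    using eventually_gt_at_top[of 0]
  proof eventually_elim
    case (elim N)
    then show ?case
      using supp by (auto simp: step_fun_eq domain_grid_def corner_in_grid)
  qed
qed

lemma step_fun_bound: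
  assumes "\<And>x. \<bar>\<phi> x\<bar> \<le> B"
  shows "\<bar>step_fun \<Omega> N \<phi> z\<bar> \<le> B"
proof (cases "N = 0")
  case True
  \<comment> \<open>The instance at 0 supplies 0 \<le> B.\<close>
  with assms[of 0] show ?thesis by (simp add: step_fun_0) 
next
  case False
  with assms[of "corner N z"] show ?thesis by (auto simp: step_fun_eq)
qed

lemma step_fun_support:
  fixes \<phi> :: "real^'n::finite \<Rightarrow> real"
  assumes "{x. \<phi> x \<noteq> 0} \<subseteq> cball 0 M" and "z \<notin> cball 0 (M + real CARD('n))"
  shows "step_fun \<Omega> N \<phi> z = 0"
proof (rule ccontr)
  assume nz: "step_fun \<Omega> N \<phi> z \<noteq> 0"
  then have N: "N > 0"
    using step_fun_0 by (metis neq0_conv)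
  with nz have "\<phi> (corner N z) \<noteq> 0"
    by (auto simp: step_fun_eq split: if_splits)
  then have "norm (corner N z) \<le> M"
    using assms(1) by (auto simp: subset_iff)
  moreover have "norm z \<le> norm (corner N z) + norm (corner N z - z)"
    by (metis norm_minus_commute norm_triangle_sub)
  ultimately show False
    using corner_norm_diff[OF N, of z] assms(2) by simp
qed

section \<open>Bounds for test functions and their grid norms\<close>

lemma test_function_continuous: "\<phi> \<in> test_functions \<Omega> \<Longrightarrow> continuous_on UNIV \<phi>"
  by (simp add: test_functions_def smooth_imp_continuous)

lemma test_function_bounded_support:
  assumes "\<phi> \<in> test_functions \<Omega>"
  obtains M where "{x. \<phi> x \<noteq> 0} \<subseteq> cball 0 M"
proof -
  have "bounded (closure {x. \<phi> x \<noteq> 0})"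
    using assms by (auto simp: test_functions_def compactly_contained_def intro: compact_imp_bounded)
  then have "bounded {x. \<phi> x \<noteq> 0}"
    by (rule bounded_subset) (rule closure_subset)
  then show thesis
    using that by (auto simp: bounded_iff subset_iff)
qed

lemma test_function_bounded:
  assumes "\<phi> \<in> test_functions \<Omega>"
  obtains B where "\<And>x. \<bar>\<phi> x\<bar> \<le> B"
proof -
  obtain M where M: "{x. \<phi> x \<noteq> 0} \<subseteq> cball 0 M"
    using assms by (rule test_function_bounded_support)
  have "compact (\<phi> ` cball 0 M)"
    by (intro compact_continuous_image compact_cball continuous_on_subset[OF test_function_continuous[OF assms]]) auto
  then obtain B where B: "\<And>x. x \<in> cball 0 M \<Longrightarrow> \<bar>\<phi> x\<bar> \<le> B"
    using compact_imp_bounded bounded_iff by (metis imageI real_norm_def)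
  have "\<bar>\<phi> x\<bar> \<le> max B 0" for x
  proof (cases "\<phi> x = 0")
    case False
    with M have "x \<in> cball 0 M" by blast
    with B[of x] show ?thesis by simp
  qed simp
  then show thesis by (rule that)
qed

lemma integral_step_fun_tendsto:
  fixes \<phi> :: "real^'n::finite \<Rightarrow> real"
  assumes g: "\<And>r. set_integrable lebesgue (cball 0 r) g"
    and cont: "continuous_on UNIV \<phi>" and supp: "{x. \<phi> x \<noteq> 0} \<subseteq> \<Omega>"
    and M: "{x. \<phi> x \<noteq> 0} \<subseteq> cball 0 M" and B: "\<And>x. \<bar>\<phi> x\<bar> \<le> B"
  shows "(\<lambda>N. LINT z|lebesgue. g z * step_fun \<Omega> N \<phi> z) \<longlonglongrightarrow> (LINT z|lebesgue. g z * \<phi> z)"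
  using g[of "M + real CARD('n)"] step_fun_lebesgue step_fun_bound[OF B] step_fun_support[OF M]
    step_fun_tendsto[OF cont supp]
  by (rule tendsto_integral_bounded_support)

text \<open>The squared grid norm is the integral of the step function of \<phi>^2. These integrals
  converge to the integral of \<phi>^2, and a convergent sequence is bounded.\<close>

lemma grid_norm_test_function_bounded:
  fixes \<phi> :: "real^'n::finite \<Rightarrow> real"
  assumes \<phi>: "\<phi> \<in> test_functions \<Omega>"
  obtains C where "\<And>N. N > 0 \<Longrightarrow> grid_norm \<Omega> N \<phi> \<le> C"
proof -
  obtain M where M: "{x. \<phi> x \<noteq> 0} \<subseteq> cball 0 M"
    using \<phi> by (rule test_function_bounded_support)
  obtain B where B: "\<And>x. \<bar>\<phi> x\<bar> \<le> B"
    using \<phi> by (rule test_function_bounded) blast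
  define \<psi> where "\<psi> x = (\<phi> x)\<^sup>2" for x
  have "(\<lambda>N. LINT z|lebesgue. 1 * step_fun \<Omega> N \<psi> z) \<longlonglongrightarrow> (LINT z|lebesgue. 1 * \<psi> z)"
  proof (rule integral_step_fun_tendsto)
    show "set_integrable lebesgue (cball (0::real^'n) r) (\<lambda>_. 1 :: real)" for r
      using lmeasurable_cball[of 0 r] by (simp add: set_integrable_def lmeasurable_iff_integrable)
    show "continuous_on UNIV \<psi>"
      unfolding \<psi>_def[abs_def] by (intro continuous_intros test_function_continuous[OF \<phi>])
    show "\<bar>\<psi> x\<bar> \<le> B\<^sup>2" for x
      using power_mono[OF B abs_ge_zero, of x 2] by (simp add: \<psi>_def)
  qed (use M test_function_support[OF \<phi>] in \<open>auto simp: \<psi>_def\<close>)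
  then have "Bseq (\<lambda>N. LINT z|lebesgue. 1 * step_fun \<Omega> N \<psi> z)"
    using convergentI convergent_imp_Bseq by blast
  then obtain K where K: "\<And>N. norm (LINT z|lebesgue. 1 * step_fun \<Omega> N \<psi> z) \<le> K"
    by (rule BseqE) blast
  have "grid_norm \<Omega> N \<phi> \<le> sqrt K" if "N > 0" for N
  proof -
    have "(LINT z|lebesgue. 1 * step_fun \<Omega> N \<psi> z) =
        (\<Sum>y\<in>domain_grid \<Omega> N. LINT z|lebesgue. \<psi> y * indicator (cube N y) z)"
      unfolding step_fun_def mult_1
      by (rule Bochner_Integration.integral_sum) (simp add: integrable_indicator_cube)
    also have "\<dots> = (1 / real N) ^ CARD('n) * (\<Sum>y\<in>domain_grid \<Omega> N. \<psi> y)"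
      by (simp add: measure_cube mult.commute flip: sum_distrib_right)
    finally have "(1 / real N) ^ CARD('n) * (\<Sum>y\<in>domain_grid \<Omega> N. \<psi> y) \<le> K"
      using K[of N] by simp
    then show ?thesis
      by (simp add: grid_norm_def \<psi>_def)
  qed
  then show thesis by (rule that)
qed

section \<open>The discrete Cauchy-Schwarz inequality and the projection\<close>

lemma grid_inner_le_grid_norm: "\<bar>grid_inner \<Omega> N f g\<bar> \<le> grid_norm \<Omega> N f * grid_norm \<Omega> N g"
proof -
  let ?c = "(1 / real N) ^ CARD('a)" and ?D = "domain_grid \<Omega> N"
  have "\<bar>grid_inner \<Omega> N f g\<bar> \<le> ?c * (\<Sum>x\<in>?D. \<bar>f x\<bar> * \<bar>g x\<bar>)"
    unfolding grid_inner_def abs_mult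
    by (intro mult_mono order_trans[OF sum_abs]) (auto simp: abs_mult)
  also have "\<dots> \<le> ?c * (L2_set f ?D * L2_set g ?D)"
    by (intro mult_left_mono L2_set_mult_ineq) auto
  also have "\<dots> = grid_norm \<Omega> N f * grid_norm \<Omega> N g"
    by (simp add: grid_norm_def L2_set_def real_sqrt_mult)
  finally show ?thesis .
qed

lemma grid_inner_diff:
  "grid_inner \<Omega> N (\<lambda>x. f x - g x) h = grid_inner \<Omega> N f h - grid_inner \<Omega> N g h"
  by (simp add: grid_inner_def left_diff_distrib sum_subtractf right_diff_distrib)

text \<open>The \<open>THE\<close> in \<open>grid_proj\<close> can be used only after unique
  existence. Pairing with the indicator of a single grid point determines the value there, the
  weight being nonzero for N > 0.\<close>

lemma grid_proj_characterization:
  fixes \<Omega> :: "(real^'n::finite) set"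
  assumes "N > 0"
  shows "grid_proj \<Omega> N g \<in> grid_fun \<Omega> N \<and> (\<forall>h\<in>grid_fun \<Omega> N.
    grid_inner \<Omega> N (grid_proj \<Omega> N g) h = (LINT z:domain_hat \<Omega> N|lebesgue. rep_L2 g z * step_fun \<Omega> N h z))"
proof -
  let ?D = "domain_grid \<Omega> N" and ?c = "(1 / real N) ^ CARD('n)"
  let ?J = "\<lambda>y. LINT z|lebesgue. rep_L2 g z * indicator (cube N y) z"
  have c: "?c \<noteq> 0" using assms by simp
  have I: "(LINT z:domain_hat \<Omega> N|lebesgue. rep_L2 g z * step_fun \<Omega> N h z) = (\<Sum>y\<in>?D. h y * ?J y)" for h
  proof -
    have int: "integrable lebesgue (\<lambda>z. rep_L2 g z * indicator (cube N y) z)" for y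
      using square_integrable_imp_set_integrable[OF square_integrable_rep_L2[of g] cube_lmeasurable[of N y]]
      by (simp add: set_integrable_def mult.commute)
    have "rep_L2 g z * step_fun \<Omega> N h z =
        (\<Sum>y\<in>?D. h y * (rep_L2 g z * indicator (cube N y) z))" for z
      by (simp add: step_fun_def sum_distrib_left mult_ac)
    then show ?thesis
      unfolding set_integral_domain_hat using int by simp
  qed
  \<comment> \<open>The weight is the measure of a cube, so this is the mean value of g over the
    cube at y.\<close>
  define p where "p y = (if y \<in> ?D then ?J y / ?c else 0)" for y
  have "\<exists>!p. p \<in> grid_fun \<Omega> N \<and> (\<forall>h\<in>grid_fun \<Omega> N.
      grid_inner \<Omega> N p h = (LINT z:domain_hat \<Omega> N|lebesgue. rep_L2 g z * step_fun \<Omega> N h z))"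
  proof (rule ex1I[of _ p], intro conjI ballI)
    show "p \<in> grid_fun \<Omega> N"
      by (simp add: grid_fun_def p_def)
    show "grid_inner \<Omega> N p h = (LINT z:domain_hat \<Omega> N|lebesgue. rep_L2 g z * step_fun \<Omega> N h z)" for h
    proof -
      have "?c * (p y * h y) = h y * ?J y" if "y \<in> ?D" for y
        using c that by (simp add: p_def)
      then show ?thesis
        unfolding I grid_inner_def sum_distrib_left by (intro sum.cong) auto
    qed
  next
    fix q assume q: "q \<in> grid_fun \<Omega> N \<and> (\<forall>h\<in>grid_fun \<Omega> N.
      grid_inner \<Omega> N q h = (LINT z:domain_hat \<Omega> N|lebesgue. rep_L2 g z * step_fun \<Omega> N h z))"
    show "q = p"
    proof
      fix y
      show "q y = p y"
      proof (cases "y \<in> ?D")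
        case True
        have delta: "(\<Sum>x\<in>?D. a x * indicator {y} x) = a y" for a :: "real^'n \<Rightarrow> real"
          using True by (simp add: indicator_def if_distrib[of "\<lambda>t. _ * t"] finite_domain_grid cong: if_cong)
        have "indicator {y} \<in> grid_fun \<Omega> N"
          using True by (auto simp: grid_fun_def indicator_def)
        then have "grid_inner \<Omega> N q (indicator {y}) = (\<Sum>x\<in>?D. indicator {y} x * ?J x)"
          using q unfolding I by blast
        also have "\<dots> = ?J y"
          using delta[of ?J] by (simp only: mult.commute)
        finally have "?c * q y = ?J y"
          by (simp only: grid_inner_def delta)
        then show ?thesis
          using True c by (simp add: p_def field_simps)
      qed (use q in \<open>simp add: p_def grid_fun_def\<close>)
    qed
  qed
  from theI'[OF this] show ?thesis
    unfolding grid_proj_def by simp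
qed

text \<open>A test function need not vanish off the grid and so need not be a grid function; but
  both sides see only its values on the grid, so it may be replaced by its restriction h.\<close>

lemma grid_inner_grid_proj:
  assumes "N > 0"
  shows "grid_inner \<Omega> N (grid_proj \<Omega> N g) \<phi> = (LINT z|lebesgue. rep_L2 g z * step_fun \<Omega> N \<phi> z)"
proof -
  define h where "h x = (if x \<in> domain_grid \<Omega> N then \<phi> x else 0)" for x
  have "h \<in> grid_fun \<Omega> N"
    by (simp add: h_def grid_fun_def)
  moreover have "grid_inner \<Omega> N f h = grid_inner \<Omega> N f \<phi>" for f
    by (simp add: grid_inner_def h_def)
  moreover have "step_fun \<Omega> N h = step_fun \<Omega> N \<phi>"
    by (simp add: step_fun_def h_def fun_eq_iff)
  ultimately show ?thesis
    using grid_proj_characterization[OF assms, of \<Omega> g] by (metis set_integral_domain_hat)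
qed

lemma grid_inner_grid_proj_tendsto:
  assumes \<phi>: "\<phi> \<in> test_functions \<Omega>"
  shows "(\<lambda>N. grid_inner \<Omega> N (grid_proj \<Omega> N g) \<phi>) \<longlonglongrightarrow> (LINT x:\<Omega>|lebesgue. rep_L2 g x * \<phi> x)"
proof -
  obtain M where M: "{x. \<phi> x \<noteq> 0} \<subseteq> cball 0 M"
    using \<phi> by (rule test_function_bounded_support)
  obtain B where B: "\<And>x. \<bar>\<phi> x\<bar> \<le> B"
    using \<phi> by (rule test_function_bounded) blast
  have "(\<lambda>N. LINT z|lebesgue. rep_L2 g z * step_fun \<Omega> N \<phi> z) \<longlonglongrightarrow> (LINT z|lebesgue. rep_L2 g z * \<phi> z)"
    by (rule integral_step_fun_tendsto[OF square_integrable_imp_set_integrable[OF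
            square_integrable_rep_L2 lmeasurable_cball] test_function_continuous[OF \<phi>]
          test_function_support[OF \<phi>] M B])
  then have "(\<lambda>N. grid_inner \<Omega> N (grid_proj \<Omega> N g) \<phi>) \<longlonglongrightarrow> (LINT z|lebesgue. rep_L2 g z * \<phi> z)"
  proof (rule Lim_transform_eventually)
    show "\<forall>\<^sub>F N in sequentially. (LINT z|lebesgue. rep_L2 g z * step_fun \<Omega> N \<phi> z) =
        grid_inner \<Omega> N (grid_proj \<Omega> N g) \<phi>"
      using eventually_gt_at_top[of 0] by eventually_elim (simp add: grid_inner_grid_proj)
  qed
  then show ?thesis
    by (simp add: set_integral_test_function[OF test_function_support[OF \<phi>]])
qed

section \<open>Transfer to the nonstandard extension\<close>

text \<open>The bridge from standard limits to the infinite grid size: a threshold m lies below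
  every infinite hypernatural.\<close>

lemma eventually_star_infinite:
  assumes "star_infinite N" "eventually P sequentially"
  shows "star_pred P N"
proof -
  obtain m where m: "\<And>n. m \<le> n \<Longrightarrow> P n"
    using assms(2) by (auto simp: eventually_sequentially)
  have "star_pred (\<lambda>k. m < k) N"
    using assms(1) by (simp add: star_infinite_def)
  then show ?thesis
    unfolding star_pred_def star_map_def
    by (transfer fixing: P m) (erule eventually_mono, rule m, simp)
qed

lemma star_infinite_fact:
  assumes "star_infinite N"
  shows "star_infinite (star_map fact N)"
  unfolding star_infinite_def
proof
  fix m :: nat
  have "star_pred (\<lambda>k. m < k) N"
    using assms by (simp add: star_infinite_def)
  then show "star_pred (\<lambda>k. m < k) (star_map fact N)"
    unfolding star_pred_def star_map_def
    by transfer (auto elim!: eventually_mono intro: less_le_trans[OF _ fact_ge_self])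
qed

lemma star_map_approx_limit:
  assumes N: "star_infinite N" and lim: "a \<longlonglongrightarrow> L"
  shows "star_map a N \<approx> star_of L"
  unfolding star_approx_def
proof (intro allI impI)
  fix r :: real assume "r > 0"
  with lim have "eventually (\<lambda>n. dist (a n) L < r) sequentially"
    by (rule tendstoD)
  then have "star_pred (\<lambda>n. dist (a n) L < r) N"
    by (rule eventually_star_infinite[OF N])
  then show "star_pred2 (\<lambda>a b. dist a b < r) (star_map a N) (star_of L)"
    unfolding star_pred_def star_pred2_def star_map2_def star_map_def by transfer
qed

lemma norm_diff_self_approx: "norm_X \<Omega> N (diff_X u u) \<approx> star_of 0"
  unfolding star_approx_def norm_X_def diff_X_def star_pred2_def star_map2_def star_map_def
  by transfer (simp add: grid_norm_def)

lemma proj_X_grid_function: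
  assumes N: "star_infinite N"
  shows "proj_X \<Omega> N g \<in> grid_functions \<Omega> N"
proof -
  have "star_pred (\<lambda>n. n > 0) N"
    by (rule eventually_star_infinite[OF N eventually_gt_at_top])
  then show ?thesis
    unfolding proj_X_def grid_functions_def internal_set_def star_pred_def star_pred2_def
      star_map2_def star_map_def mem_Collect_eq
    by transfer (auto elim!: eventually_mono simp: grid_proj_characterization)
qed

lemma nearstandard_proj_X:
  assumes "star_infinite N" "g \<in> L2_on \<Omega>"
  shows "nearstandard_L2 \<Omega> N (proj_X \<Omega> N g)"
  using assms norm_diff_self_approx by (auto simp: nearstandard_L2_def proj_X_grid_function)

lemma inner_proj_X_approx:
  assumes "star_infinite N" "\<phi> \<in> test_functions \<Omega>"
  shows "inner_X \<Omega> N (proj_X \<Omega> N g) (star_of \<phi>)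
    \<approx> star_of (LINT x:\<Omega>|lebesgue. rep_L2 g x * \<phi> x)"
proof -
  \<comment> \<open>Since g and \<phi> are standard, the pairing is the value at \<open>N\<close> of
    a standard sequence.\<close>
  have "inner_X \<Omega> N (proj_X \<Omega> N g) (star_of \<phi>) =
      star_map (\<lambda>n. grid_inner \<Omega> n (grid_proj \<Omega> n g) \<phi>) N"
    unfolding inner_X_def proj_X_def star_map3_def star_map2_def star_map_def
    by transfer (auto simp: star_eq_def intro: admissible_app[OF admissible_const])
  then show ?thesis
    using star_map_approx_limit[OF assms(1) grid_inner_grid_proj_tendsto[OF assms(2)]] by simp
qed

text \<open>For fixed r the three approximations and 0 < N hold at a common index, which yields
  standard n, f, g. Cauchy-Schwarz is applied to these, with a bound on the norm of \<phi> that does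
  not depend on n; finally r tends to 0.\<close>

lemma standard_parts_of_inner_eq:
  fixes \<Omega> :: "(real^'n::finite) set" and N :: "(nat, 'i::nonstandard_index) star"
  assumes N: "star_infinite N" and \<phi>: "\<phi> \<in> test_functions \<Omega>"
    and near: "norm_X \<Omega> N (diff_X u w) \<approx> star_of 0"
    and u: "inner_X \<Omega> N u (star_of \<phi>) \<approx> star_of a"
    and w: "inner_X \<Omega> N w (star_of \<phi>) \<approx> star_of b"
  shows "a = b"
proof -
  obtain C where C: "\<And>n. n > 0 \<Longrightarrow> grid_norm \<Omega> n \<phi> \<le> C"
    using \<phi> by (rule grid_norm_test_function_bounded) blast
  \<comment> \<open>The Cauchy-Schwarz estimate costs r |C|, and replacing the two pairings by a and
    b costs r each. The absolute value keeps the factor positive for the division below.\<close>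
  have bound: "\<bar>a - b\<bar> \<le> r * (\<bar>C\<bar> + 2)" if "r > 0" for r :: real
  proof -
    have "star_pred (\<lambda>n. n > 0) N"
      by (rule eventually_star_infinite[OF N eventually_gt_at_top])
    moreover have "star_pred2 (\<lambda>a b. dist a b < r) (norm_X \<Omega> N (diff_X u w)) (star_of 0)"
      "star_pred2 (\<lambda>a b. dist a b < r) (inner_X \<Omega> N u (star_of \<phi>)) (star_of a)"
      "star_pred2 (\<lambda>a b. dist a b < r) (inner_X \<Omega> N w (star_of \<phi>)) (star_of b)"
      using near u w \<open>r > 0\<close> by (simp_all add: star_approx_def)
    ultimately have "\<exists>n f g. n > 0 \<and> dist (grid_norm \<Omega> n (\<lambda>x. f x - g x)) 0 < r \<and>
        dist (grid_inner \<Omega> n f \<phi>) a < r \<and> dist (grid_inner \<Omega> n g \<phi>) b < r"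
      unfolding star_pred_def star_pred2_def norm_X_def inner_X_def diff_X_def
        star_map3_def star_map2_def star_map_def
    proof (transfer fixing: \<Omega> \<phi> a b r)
      fix N :: "'i \<Rightarrow> nat" and u w :: "'i \<Rightarrow> real^'n \<Rightarrow> real"
      assume "\<forall>\<^sub>F i in ultra. 0 < N i"
        "\<forall>\<^sub>F i in ultra. dist (grid_norm \<Omega> (N i) (\<lambda>x. u i x - w i x)) 0 < r"
        "\<forall>\<^sub>F i in ultra. dist (grid_inner \<Omega> (N i) (u i) \<phi>) a < r"
        "\<forall>\<^sub>F i in ultra. dist (grid_inner \<Omega> (N i) (w i) \<phi>) b < r"
      then have "\<forall>\<^sub>F i::'i in ultra. \<exists>n f g. n > 0 \<and> dist (grid_norm \<Omega> n (\<lambda>x. f x - g x)) 0 < r \<and>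
          dist (grid_inner \<Omega> n f \<phi>) a < r \<and> dist (grid_inner \<Omega> n g \<phi>) b < r"
        by eventually_elim blast
      then show "\<exists>n f g. n > 0 \<and> dist (grid_norm \<Omega> n (\<lambda>x. f x - g x)) 0 < r \<and>
          dist (grid_inner \<Omega> n f \<phi>) a < r \<and> dist (grid_inner \<Omega> n g \<phi>) b < r"
        \<comment> \<open>A statement free of the index that holds eventually along a proper filter
          is true.\<close>
        using ultra_proper by (auto simp: eventually_const_iff)
    qed
    then obtain n f g where n: "n > 0" and near: "\<bar>grid_norm \<Omega> n (\<lambda>x. f x - g x)\<bar> < r"
      and f: "\<bar>grid_inner \<Omega> n f \<phi> - a\<bar> < r" and g: "\<bar>grid_inner \<Omega> n g \<phi> - b\<bar> < r"
      by (auto simp: dist_real_def)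
    have "\<bar>grid_inner \<Omega> n f \<phi> - grid_inner \<Omega> n g \<phi>\<bar> \<le>
        grid_norm \<Omega> n (\<lambda>x. f x - g x) * grid_norm \<Omega> n \<phi>"
      using grid_inner_le_grid_norm[of \<Omega> n "\<lambda>x. f x - g x" \<phi>] by (simp add: grid_inner_diff)
    also have "\<dots> \<le> r * \<bar>C\<bar>"
      using near C[OF n] \<open>r > 0\<close> by (intro mult_mono) (auto simp: grid_norm_def sum_nonneg)
    finally show ?thesis
      using f g by (simp add: algebra_simps)
  qed
  have "\<bar>a - b\<bar> \<le> 0"
  proof (rule field_le_epsilon)
    fix e :: real assume "e > 0"
    then show "\<bar>a - b\<bar> \<le> 0 + e"
      using bound[of "e / (\<bar>C\<bar> + 2)"] by simp
  qed
  then show ?thesis by simp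
qed

lemma L2_eq_if_class_reps_near:
  assumes N: "star_infinite N" and "open \<Omega>" and gh: "g \<in> L2_on \<Omega>" "h \<in> L2_on \<Omega>"
    and near: "norm_X \<Omega> N (diff_X u w) \<approx> star_of 0"
    and u: "\<And>\<phi>. \<phi> \<in> test_functions \<Omega> \<Longrightarrow> inner_X \<Omega> N u (star_of \<phi>)
      \<approx> star_of (LINT x:\<Omega>|lebesgue. rep_L2 g x * \<phi> x)"
    and w: "\<And>\<phi>. \<phi> \<in> test_functions \<Omega> \<Longrightarrow> inner_X \<Omega> N w (star_of \<phi>)
      \<approx> star_of (LINT x:\<Omega>|lebesgue. rep_L2 h x * \<phi> x)"
  shows "g = h"
  using \<open>open \<Omega>\<close> gh standard_parts_of_inner_eq[OF N _ near u w]
  by (rule L2_eq_if_test_integrals_eq)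

theorem theorem5p10:
  fixes \<Omega> :: "(real^'n::finite) set"
    and N0 N :: "(nat, 'i::nonstandard_index) star"
    and F :: "'n L2 \<Rightarrow> 'n L2"
    and FX :: "('n, 'i) internal_fun \<Rightarrow> ('n, 'i) internal_fun"
    and f :: "'n L2"
  assumes saturation: "saturated (distributions \<Omega>) TYPE(real^'n \<Rightarrow> real) TYPE('i)"
    and N0_infinite: "star_infinite N0"
    and N_eq: "N = star_map fact N0"
    and Omega_open: "open \<Omega>"
    and Omega_finite_measure: "\<Omega> \<in> lmeasurable"
    and F_maps: "F \<in> L2_on \<Omega> \<rightarrow> L2_on \<Omega>"
    and FX_maps: "FX \<in> grid_functions \<Omega> N \<rightarrow> grid_functions \<Omega> N"
    and FX_continuous: "\<And>u v. nearstandard_L2 \<Omega> N u \<Longrightarrow> nearstandard_L2 \<Omega> N v \<Longrightarrow>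
      norm_X \<Omega> N (diff_X u v) \<approx> star_of 0 \<Longrightarrow> norm_X \<Omega> N (diff_X (FX u) (FX v)) \<approx> star_of 0"
    and FX_represents_F: "\<And>g. g \<in> L2_on \<Omega> \<Longrightarrow> class_is \<Omega> N (FX (proj_X \<Omega> N g)) (F g)"
    and f_L2: "f \<in> L2_on \<Omega>"
  shows "((\<exists>v\<in>L2_on \<Omega>. F v = f) \<longleftrightarrow>
      (\<exists>u fX. nearstandard_L2 \<Omega> N u \<and> fX \<in> grid_functions \<Omega> N \<and> class_is \<Omega> N fX f \<and> FX u = fX))
    \<and> ((\<exists>u. nearstandard_L2 \<Omega> N u \<and> FX u = proj_X \<Omega> N f) \<longrightarrow> (\<exists>v\<in>L2_on \<Omega>. F v = f))"
proof -
  have N: "star_infinite N"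
    unfolding N_eq using N0_infinite by (rule star_infinite_fact)
  \<comment> \<open>The condition on \<open>FX u\<close> speaks of pairings with standard test
    functions, so it covers both a right-hand side whose class is f and the projection of f. The
    solution is the element of L2 to which u is near.\<close>
  have sol: "\<exists>v\<in>L2_on \<Omega>. F v = f"
    if u: "nearstandard_L2 \<Omega> N u" and FXu: "\<And>\<phi>. \<phi> \<in> test_functions \<Omega> \<Longrightarrow>
      inner_X \<Omega> N (FX u) (star_of \<phi>) \<approx> star_of (LINT x:\<Omega>|lebesgue. rep_L2 f x * \<phi> x)" for u
  proof -
    obtain g where g: "g \<in> L2_on \<Omega>" and near: "norm_X \<Omega> N (diff_X u (proj_X \<Omega> N g)) \<approx> star_of 0"
      using u by (auto simp: nearstandard_L2_def)
    have "norm_X \<Omega> N (diff_X (FX u) (FX (proj_X \<Omega> N g))) \<approx> star_of 0"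
      by (rule FX_continuous[OF u nearstandard_proj_X[OF N g] near])
    moreover have "F g \<in> L2_on \<Omega>"
      using F_maps g by auto
    ultimately have "f = F g"
      using FXu FX_represents_F[OF g]
      by (intro L2_eq_if_class_reps_near[OF N Omega_open f_L2]) (auto simp: class_is_def)
    with g show ?thesis by auto
  qed
  show ?thesis
  proof (intro conjI iffI impI)
    assume "\<exists>v\<in>L2_on \<Omega>. F v = f"
    then obtain v where v: "v \<in> L2_on \<Omega>" "F v = f" by blast
    have "FX (proj_X \<Omega> N v) \<in> grid_functions \<Omega> N"
      using FX_maps proj_X_grid_function[OF N] by auto
    with v FX_represents_F[OF v(1)] nearstandard_proj_X[OF N v(1)]
    show "\<exists>u fX. nearstandard_L2 \<Omega> N u \<and> fX \<in> grid_functions \<Omega> N \<and> class_is \<Omega> N fX f \<and> FX u = fX"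
      by auto
  next
    assume "\<exists>u fX. nearstandard_L2 \<Omega> N u \<and> fX \<in> grid_functions \<Omega> N \<and> class_is \<Omega> N fX f \<and> FX u = fX"
    then show "\<exists>v\<in>L2_on \<Omega>. F v = f"
      using sol by (auto simp: class_is_def)
  next
    assume "\<exists>u. nearstandard_L2 \<Omega> N u \<and> FX u = proj_X \<Omega> N f"
    then obtain u where u: "nearstandard_L2 \<Omega> N u" and FXu: "FX u = proj_X \<Omega> N f" by blast
    show "\<exists>v\<in>L2_on \<Omega>. F v = f"
      using inner_proj_X_approx[OF N, where g = f] by (intro sol[OF u]) (simp add: FXu)
  qed
qed

end
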